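(* Suppose $\Delta\subseteq\Gamma$ are countably infinite groups ($\Delta$ a subgroup of $\Gamma$) and that the inclusion $\Delta\subseteq\Gamma$ admits UFOs. Let $k\in\mathbb{N}$. Then the set $\{X\in\overline{\mathcal{S}}(k^\Gamma) : X\text{ is minimal as a }\Delta\text{-flow}\}$ is a dense $G_\delta$ subset of $\overline{\mathcal{S}}(k^\Gamma)$. Similarly, the set $\{X\in\overline{\mathcal{S}}((2^{\mathbb{N}})^\Gamma) : X\text{ is minimal as a }\Delta\text{-flow}\}$ is a dense $G_\delta$ subset of $\overline{\mathcal{S}}((2^{\mathbb{N}})^\Gamma)$.
   Context: UFOs: for a finite $U\subseteq\Gamma$, a set $S\subseteq\Gamma$ is $U$-spaced if for all $g\neq h$ in $S$ we have $h\notin Ug$; a maximal $U$-spaced set is a $U$-spaced set which is maximal under inclusion. A finite $U\subseteq\Gamma$ is a $(\Gamma,\Delta)$-UFO if every maximal $U$-spaced set $S\subseteq\Gamma$ meets every right coset $\Delta g$ of $\Delta$ in $\Gamma$. The inclusion $\Delta\subseteq\Gamma$ admits UFOs if for every finite $U\subseteq\Gamma$ there is a finite $V\subseteq\Gamma$ with $V\supseteq U$ which is a $(\Gamma,\Delta)$-UFO. Subshifts: identify $k$ with $\{0,\dots,k-1\}$. For $A$ a finite set or $A=2^{\mathbb{N}}$ (Cantor space), $\Gamma$ acts on $A^\Gamma$ (product topology, finite $A$ discrete) by $(g\cdot x)(h)=x(hg)$. A subshift of $A^\Gamma$ is a non-empty closed $\Gamma$-invariant subset; $\mathrm{Sub}(A^\Gamma)$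 is the space of subshifts. For finite $A$, the Vietoris topology on $\mathrm{Sub}(A^\Gamma)$ has as basic open neighborhoods of $X$ the sets $\{Y : P_U(Y)=P_U(X)\}$ for finite $U\subseteq\Gamma$, where $P_U(X)=\{x|_U : x\in X\}\subseteq A^U$. For $n<\omega$ let $\pi_n\colon 2^{\mathbb{N}}\to 2^n$ be restriction to the first $n$ entries, $\tilde\pi_n\colon(2^{\mathbb{N}})^\Gamma\to(2^n)^\Gamma$, $\tilde\pi_n(x)(g)=\pi_n(x(g))$, and $\overline{\pi}_n(X)=\tilde\pi_n[X]$; the Vietoris topology on $\mathrm{Sub}((2^{\mathbb{N}})^\Gamma)$ is the coarsest making every $\overline{\pi}_n\colon\mathrm{Sub}((2^{\mathbb{N}})^\Gamma)\to\mathrm{Sub}((2^n)^\Gamma)$ continuous ($2^n$ viewed as a finite alphabet). Strong irreducibility: $S,T\subseteq\Gamma$ are $U$-apart if $US\cap T=\emptyset$ and $S\cap UT=\emptyset$. For finite $A$, a subshift $X\subseteq A^\Gamma$ is strongly irreducible if there is a finite $U\subseteq\Gamma$ such that for any $x_0,x_1\in X$ and any $U$-apart $S_0,S_1\subseteq\Gamma$ there is $y\in X$ with $y|_{S_i}=x_i|_{S_i}$ for $i<2$. A subshift $X\subseteq(2^{\mathbb{N}})^\Gamma$ is strongly irreducible if $\overline{\pi}_n(X)\subseteq(2^n)^\Gamma$ is strongly irreducible for every $n<\omega$. $\mathcal{S}(A^\Gamma)$ is the set of strongly irreducible subshifts and $\overline{\mathcal{S}}(A^\Gamma)$ its closure in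 $\mathrm{Sub}(A^\Gamma)$, with the subspace topology. $X$ is minimal as a $\Delta$-flow if every $\Delta$-orbit in $X$ is dense in $X$. *)

theory Defs
  imports "HOL-Algebra.Coset" "HOL-Analysis.Analysis"
begin

(* clashes with the topological closure_of *)
no_notation eq_closure_of (\<open>closure'_of\<index>\<close>)

definition spaced :: "('a, 'b) monoid_scheme \<Rightarrow> 'a set \<Rightarrow> 'a set \<Rightarrow> bool" where
  "spaced G U S \<longleftrightarrow> S \<subseteq> carrier G \<and> (\<forall>g\<in>S. \<forall>h\<in>S. g \<noteq> h \<longrightarrow> h \<notin> U #>\<^bsub>G\<^esub> g)"

definition maximal_spaced :: "('a, 'b) monoid_scheme \<Rightarrow> 'a set \<Rightarrow> 'a set \<Rightarrow> bool" where
  "maximal_spaced G U S \<longleftrightarrow> spaced G U S \<and> (\<forall>S'. spaced G U S' \<and> S \<subseteq> S' \<longrightarrow> S' = S)"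

definition UFO :: "('a, 'b) monoid_scheme \<Rightarrow> 'a set \<Rightarrow> 'a set \<Rightarrow> bool" where
  "UFO G D U \<longleftrightarrow> finite U \<and> U \<subseteq> carrier G \<and>
     (\<forall>S. maximal_spaced G U S \<longrightarrow> (\<forall>C \<in> rcosets\<^bsub>G\<^esub> D. S \<inter> C \<noteq> {}))"

definition admits_UFOs :: "('a, 'b) monoid_scheme \<Rightarrow> 'a set \<Rightarrow> bool" where
  "admits_UFOs G D \<longleftrightarrow>
     (\<forall>U. finite U \<and> U \<subseteq> carrier G \<longrightarrow> (\<exists>V. U \<subseteq> V \<and> UFO G D V))"

text \<open>
  An alphabet is given as a topology \<open>A\<close>; its configurations are the functions in
  \<open>carrier G \<rightarrow>\<^sub>E topspace A\<close>, i.e. they take the value \<open>undefined\<close> outside \<open>carrier G\<close>.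
\<close>

definition config_top :: "('a, 'b) monoid_scheme \<Rightarrow> 'c topology \<Rightarrow> ('a \<Rightarrow> 'c) topology" where
  "config_top G A = product_topology (\<lambda>_. A) (carrier G)"

definition shift :: "('a, 'b) monoid_scheme \<Rightarrow> 'a \<Rightarrow> ('a \<Rightarrow> 'c) \<Rightarrow> ('a \<Rightarrow> 'c)" where
  "shift G g x = (\<lambda>h\<in>carrier G. x (h \<otimes>\<^bsub>G\<^esub> g))"

definition Sub :: "('a, 'b) monoid_scheme \<Rightarrow> 'c topology \<Rightarrow> ('a \<Rightarrow> 'c) set set" where
  "Sub G A = {X. X \<noteq> {} \<and> closedin (config_top G A) X \<and>
                 (\<forall>g\<in>carrier G. \<forall>x\<in>X. shift G g x \<in> X)}"

definition minimal_flow ::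
  "('a, 'b) monoid_scheme \<Rightarrow> 'c topology \<Rightarrow> 'a set \<Rightarrow> ('a \<Rightarrow> 'c) set \<Rightarrow> bool" where
  "minimal_flow G A D X \<longleftrightarrow>
     (\<forall>x\<in>X. subtopology (config_top G A) X closure_of ((\<lambda>g. shift G g x) ` D) = X)"

definition apart :: "('a, 'b) monoid_scheme \<Rightarrow> 'a set \<Rightarrow> 'a set \<Rightarrow> 'a set \<Rightarrow> bool" where
  "apart G U S T \<longleftrightarrow> (U <#>\<^bsub>G\<^esub> S) \<inter> T = {} \<and> S \<inter> (U <#>\<^bsub>G\<^esub> T) = {}"

definition patterns :: "'a set \<Rightarrow> ('a \<Rightarrow> 'c) set \<Rightarrow> ('a \<Rightarrow> 'c) set" where
  "patterns U X = (\<lambda>x. restrict x U) ` X"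

abbreviation Sub_fin :: "('a, 'b) monoid_scheme \<Rightarrow> 'c set \<Rightarrow> ('a \<Rightarrow> 'c) set set" where
  "Sub_fin G A \<equiv> Sub G (discrete_topology A)"

text \<open>
  The generating sets form a base: the sets for \<open>U \<union> V\<close> refine those for \<open>U\<close> and \<open>V\<close>.
\<close>

definition vietoris_fin :: "('a, 'b) monoid_scheme \<Rightarrow> 'c set \<Rightarrow> ('a \<Rightarrow> 'c) set topology" where
  "vietoris_fin G A = topology_generated_by
     {{Y \<in> Sub_fin G A. patterns U Y = patterns U X} | X U.
        X \<in> Sub_fin G A \<and> finite U \<and> U \<subseteq> carrier G}"

definition strongly_irreducible_fin ::
  "('a, 'b) monoid_scheme \<Rightarrow> 'c set \<Rightarrow> ('a \<Rightarrow> 'c) set \<Rightarrow> bool" where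
  "strongly_irreducible_fin G A X \<longleftrightarrow> X \<in> Sub_fin G A \<and>
     (\<exists>U. finite U \<and> U \<subseteq> carrier G \<and>
        (\<forall>x\<^sub>0\<in>X. \<forall>x\<^sub>1\<in>X. \<forall>S\<^sub>0 S\<^sub>1. S\<^sub>0 \<subseteq> carrier G \<and> S\<^sub>1 \<subseteq> carrier G \<and> apart G U S\<^sub>0 S\<^sub>1 \<longrightarrow>
           (\<exists>y\<in>X. restrict y S\<^sub>0 = restrict x\<^sub>0 S\<^sub>0 \<and> restrict y S\<^sub>1 = restrict x\<^sub>1 S\<^sub>1)))"

definition SI_closure_fin :: "('a, 'b) monoid_scheme \<Rightarrow> 'c set \<Rightarrow> ('a \<Rightarrow> 'c) set set" where
  "SI_closure_fin G A = vietoris_fin G A closure_of {X. strongly_irreducible_fin G A X}"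

definition SI_closure_fin_top ::
  "('a, 'b) monoid_scheme \<Rightarrow> 'c set \<Rightarrow> ('a \<Rightarrow> 'c) set topology" where
  "SI_closure_fin_top G A = subtopology (vietoris_fin G A) (SI_closure_fin G A)"

definition cantor :: "(nat \<Rightarrow> nat) topology" where
  "cantor = product_topology (\<lambda>_. discrete_topology {..<2}) UNIV"

definition words :: "nat \<Rightarrow> (nat \<Rightarrow> nat) set" where
  "words n = {..<n} \<rightarrow>\<^sub>E {..<2}"

abbreviation Sub_cantor :: "('a, 'b) monoid_scheme \<Rightarrow> ('a \<Rightarrow> nat \<Rightarrow> nat) set set" where
  "Sub_cantor G \<equiv> Sub G cantor"

definition trunc ::
  "('a, 'b) monoid_scheme \<Rightarrow> nat \<Rightarrow> ('a \<Rightarrow> nat \<Rightarrow> nat) \<Rightarrow> ('a \<Rightarrow> nat \<Rightarrow> nat)" where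
  "trunc G n x = (\<lambda>g\<in>carrier G. restrict (x g) {..<n})"

text \<open>
  The coarsest topology on the space of subshifts over the Cantor alphabet for which
  each map \<open>X \<mapsto> trunc G n ` X\<close> into \<open>vietoris_fin G (words n)\<close> is continuous.
\<close>

definition vietoris_cantor ::
  "('a, 'b) monoid_scheme \<Rightarrow> ('a \<Rightarrow> nat \<Rightarrow> nat) set topology" where
  "vietoris_cantor G = topology_generated_by
     {{X \<in> Sub_cantor G. trunc G n ` X \<in> W} | n W. openin (vietoris_fin G (words n)) W}"

definition strongly_irreducible_cantor ::
  "('a, 'b) monoid_scheme \<Rightarrow> ('a \<Rightarrow> nat \<Rightarrow> nat) set \<Rightarrow> bool" where
  "strongly_irreducible_cantor G X \<longleftrightarrow> X \<in> Sub_cantor G \<and>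
     (\<forall>n. strongly_irreducible_fin G (words n) (trunc G n ` X))"

definition SI_closure_cantor ::
  "('a, 'b) monoid_scheme \<Rightarrow> ('a \<Rightarrow> nat \<Rightarrow> nat) set set" where
  "SI_closure_cantor G = vietoris_cantor G closure_of {X. strongly_irreducible_cantor G X}"

definition SI_closure_cantor_top ::
  "('a, 'b) monoid_scheme \<Rightarrow> ('a \<Rightarrow> nat \<Rightarrow> nat) set topology" where
  "SI_closure_cantor_top G = subtopology (vietoris_cantor G) (SI_closure_cantor G)"

definition dense_gdelta_in :: "'c topology \<Rightarrow> 'c set \<Rightarrow> bool" where
  "dense_gdelta_in T M \<longleftrightarrow> gdelta_in T M \<and> T closure_of M = topspace T"

end

theory Submission
  imports Defs
begin

text \<open>
  Let \<open>X\<close> be strongly irreducible with window \<open>U\<close> and let \<open>F\<close> be finite. All \<open>F\<close>-patterns of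
  \<open>X\<close> can be placed, at positions in the infinite subgroup \<open>D\<close> that are far apart, into a single
  configuration \<open>z \<in> X\<close>, in a finite window \<open>B\<close>. For a UFO \<open>V\<close> that is large compared with \<open>U\<close> and
  \<open>B\<close>, consider the configurations in \<open>X\<close> that show \<open>z\<close> on \<open>B\<close> at every point of some maximal
  \<open>V\<close>-spaced set. They form a subshift with the same \<open>F\<close>-patterns which is again strongly
  irreducible, because maximal \<open>V\<close>-spaced sets can be spliced as well; and since such a set meets
  \<open>D\<close>, every \<open>F\<close>-pattern occurs along every \<open>D\<close>-orbit. Iterating along an exhaustion of the group
  and intersecting gives a \<open>D\<close>-minimal subshift in the closure that is as close to \<open>X\<close> as desired;
  no Baire category argument is needed. The Cantor alphabet reduces to the finite alphabets by
  truncation and extension by zeros.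
\<close>
subsection \<open>Configuration spaces\<close>

text \<open>Imposing a condition on a subshift easily destroys strong irreducibility: two
  configurations may satisfy it in incompatible ways. Windows prescribed at a maximal spaced set
  avoid this, because any spaced partial choice of markers extends to a maximal one. When two
  configurations are spliced, the markers near either side are kept and the others are chosen
  afresh. The danger is a fresh marker whose window runs into a prescribed region; maximality of the
  old marker set excludes it, since such a marker would be blocked by an old one that was kept. For
  the G-delta half, minimality splits into countably many conditions, one for each finite window and
  each level of the alphabet: every pattern occurs along every orbit of \<open>D\<close>. By
  compactness finitely many translates from \<open>D\<close> suffice, so each condition depends only
  on the patterns in a larger finite window and is open in the Vietoris topology.\<close>

definition code :: "('a, 'b) monoid_scheme \<Rightarrow> ('c \<Rightarrow> 'd) \<Rightarrow> ('a \<Rightarrow> 'c) \<Rightarrow> ('a \<Rightarrow> 'd)" where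
  "code G f x = (\<lambda>g\<in>carrier G. f (x g))"

text \<open>\<open>D\<close> is an arbitrary set of translates here, because
  \<open>recurrent_uniform\<close> trades the subgroup for a finite subset. The translate stands on
  the right, as in \<open>shift G d x\<close>.\<close>

definition recurrent :: "('a, 'b) monoid_scheme \<Rightarrow> 'a set \<Rightarrow> 'a set \<Rightarrow> ('a \<Rightarrow> 'c) set \<Rightarrow> bool" where
  "recurrent G D F X \<longleftrightarrow> (\<forall>x\<in>X. \<forall>y\<in>X. \<exists>d\<in>D. \<forall>g\<in>F. x (g \<otimes>\<^bsub>G\<^esub> d) = y g)"

text \<open>
  The fibres of \<open>f n\<close> are open and shrink to a neighbourhood base as \<open>n\<close> grows. Finite alphabets
  (with the identity) and the Cantor alphabet (with truncation to \<open>n\<close> digits) are treated together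
  in this way.
\<close>

definition level_base :: "'c topology \<Rightarrow> (nat \<Rightarrow> 'c \<Rightarrow> 'd) \<Rightarrow> bool" where
  "level_base A f \<longleftrightarrow>
     (\<forall>n. \<forall>a\<in>topspace A. openin A {b \<in> topspace A. f n b = f n a}) \<and>
     (\<forall>U a. openin A U \<longrightarrow> a \<in> U \<longrightarrow> (\<exists>n. \<forall>b\<in>topspace A. f n b = f n a \<longrightarrow> b \<in> U)) \<and>
     (\<forall>m n a b. m \<le> n \<longrightarrow> f n a = f n b \<longrightarrow> f m a = f m b)"

lemma level_base_nhd:
  "level_base A f \<Longrightarrow> openin A U \<Longrightarrow> a \<in> U \<Longrightarrow> \<exists>n. \<forall>b\<in>topspace A. f n b = f n a \<longrightarrow> b \<in> U"
  by (simp add: level_base_def)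

lemma level_base_mono: "level_base A f \<Longrightarrow> m \<le> n \<Longrightarrow> f n a = f n b \<Longrightarrow> f m a = f m b"
  unfolding level_base_def by metis

lemma level_base_discrete: "level_base (discrete_topology A) (\<lambda>_ a. a)"
  by (auto simp: level_base_def)

section \<open>Cylinder neighbourhoods in product spaces\<close>

lemma openin_cylinder:
  assumes "level_base A f" "finite F" "F \<subseteq> I" "\<And>i. i \<in> F \<Longrightarrow> y i \<in> topspace A"
  shows "openin (product_topology (\<lambda>_. A) I) {z \<in> I \<rightarrow>\<^sub>E topspace A. \<forall>i\<in>F. f n (z i) = f n (y i)}"
proof -
  have "{z \<in> I \<rightarrow>\<^sub>E topspace A. \<forall>i\<in>F. f n (z i) = f n (y i)} =
      (\<Pi>\<^sub>E i\<in>I. if i \<in> F then {b \<in> topspace A. f n b = f n (y i)} else topspace A)"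
    using assms(3) by (auto simp: PiE_iff extensional_def split: if_splits)
  moreover have "openin (product_topology (\<lambda>_. A) I) \<dots>"
  proof (rule product_topology_basis)
    show "openin A (if i \<in> F then {b \<in> topspace A. f n b = f n (y i)} else topspace A)" for i
      using assms(1,4) by (simp add: level_base_def)
    show "finite {i. (if i \<in> F then {b \<in> topspace A. f n b = f n (y i)} else topspace A) \<noteq> topspace A}"
      by (rule finite_subset[OF _ assms(2)]) auto
  qed
  ultimately show ?thesis by simp
qed

text \<open>A basic open set restricts finitely many coordinates, each through some level; by
  monotonicity the largest of these levels serves them all.\<close>

lemma openin_product_contains_cylinder:
  assumes "level_base A f" "openin (product_topology (\<lambda>_. A) I) T" "y \<in> T"
  shows "\<exists>F n. finite F \<and> F \<subseteq> I \<and> (\<forall>z\<in>I \<rightarrow>\<^sub>E topspace A. (\<forall>i\<in>F. f n (z i) = f n (y i)) \<longrightarrow> z \<in> T)"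
proof -
  obtain W where "finite {i \<in> I. W i \<noteq> topspace A} \<and> (\<forall>i\<in>I. openin A (W i)) \<and> y \<in> Pi\<^sub>E I W \<and> Pi\<^sub>E I W \<subseteq> T"
    using bspec[OF iffD1[OF openin_product_topology_alt assms(2)] assms(3)] ..
  then have W: "finite {i \<in> I. W i \<noteq> topspace A}" "\<And>i. i \<in> I \<Longrightarrow> openin A (W i)"
      "y \<in> Pi\<^sub>E I W" "Pi\<^sub>E I W \<subseteq> T"
    by simp_all
  define F where "F = {i \<in> I. W i \<noteq> topspace A}"
  have "\<exists>n. \<forall>b\<in>topspace A. f n b = f n (y i) \<longrightarrow> b \<in> W i" if "i \<in> F" for i
    using W(2)[of i] W(3) that unfolding F_def by (intro level_base_nhd[OF assms(1)]) auto
  then obtain N where N: "\<And>i b. i \<in> F \<Longrightarrow> b \<in> topspace A \<Longrightarrow> f (N i) b = f (N i) (y i) \<Longrightarrow> b \<in> W i"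
    by metis
  \<comment> \<open>\<open>insert 0\<close> covers the case of no restricted coordinate.\<close>
  define n where "n = Max (insert 0 (N ` F))"
  have Nn: "N i \<le> n" if "i \<in> F" for i
    using that W(1) unfolding n_def F_def by (intro Max_ge) auto
  have "z \<in> T" if z: "z \<in> I \<rightarrow>\<^sub>E topspace A" "\<forall>i\<in>F. f n (z i) = f n (y i)" for z
  proof -
    have "z i \<in> W i" if i: "i \<in> I" for i
    proof (cases "i \<in> F")
      case True
      then have "f (N i) (z i) = f (N i) (y i)"
        using level_base_mono[OF assms(1) Nn[OF True]] z(2) by blast
      then show ?thesis using N[OF True] z(1) i by blast
    next
      case False
      then show ?thesis using z(1) i unfolding F_def by auto
    qed
    then have "z \<in> Pi\<^sub>E I W" using z(1) by (simp add: PiE_iff)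
    then show ?thesis using W(4) by blast
  qed
  moreover have "finite F" "F \<subseteq> I"
    using W(1) by (auto simp: F_def)
  ultimately show ?thesis by blast
qed

text \<open>The Cantor alphabet is itself a product of discrete two-point spaces, so both cylinder
  lemmas apply with the naturals as index set; a finite set of positions lies below some
  \<open>n\<close>, which is the level.\<close>

lemma level_base_cantor: "level_base cantor (\<lambda>n a. restrict a {..<n})"
  unfolding level_base_def
proof (intro conjI allI ballI impI)
  fix n and a :: "nat \<Rightarrow> nat" assume a: "a \<in> topspace cantor"
  have "{b \<in> topspace cantor. restrict b {..<n} = restrict a {..<n}}
      = {z \<in> UNIV \<rightarrow>\<^sub>E topspace (discrete_topology {..<2}). \<forall>i\<in>{..<n}. z i = a i}"
    by (auto simp: cantor_def restrict_def fun_eq_iff)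
  then show "openin cantor {b \<in> topspace cantor. restrict b {..<n} = restrict a {..<n}}"
    using openin_cylinder[OF level_base_discrete, of "{..<n}" UNIV a "{..<2}"] a
    unfolding cantor_def by auto
next
  fix U and a :: "nat \<Rightarrow> nat" assume "openin cantor U" "a \<in> U"
  then obtain F where F: "finite F" "\<forall>z\<in>UNIV \<rightarrow>\<^sub>E {..<2}. (\<forall>i\<in>F. z i = a i) \<longrightarrow> z \<in> U"
    using openin_product_contains_cylinder[OF level_base_discrete, of "{..<2}" UNIV U a]
    unfolding cantor_def by auto
  then obtain n where "F \<subseteq> {..<n}" using finite_nat_iff_bounded by auto
  then have "\<forall>b\<in>topspace cantor. restrict b {..<n} = restrict a {..<n} \<longrightarrow> b \<in> U"
    using F(2) unfolding cantor_def by (auto simp: restrict_def fun_eq_iff) (metis lessThan_iff subsetD)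
  then show "\<exists>n. \<forall>b\<in>topspace cantor. restrict b {..<n} = restrict a {..<n} \<longrightarrow> b \<in> U" ..
next
  fix m n :: nat and a b :: "nat \<Rightarrow> nat" assume "m \<le> n" "restrict a {..<n} = restrict b {..<n}"
  then show "restrict a {..<m} = restrict b {..<m}"
    by (auto simp: restrict_def fun_eq_iff) (metis order_less_le_trans)
qed

section \<open>Closed sets of configurations and compactness\<close>

lemma topspace_config_top [simp]: "topspace (config_top G A) = carrier G \<rightarrow>\<^sub>E topspace A"
  by (simp add: config_top_def)

lemma compact_config_top: "compact_space A \<Longrightarrow> compact_space (config_top G A)"
  by (simp add: config_top_def compact_space_product_topology)

lemma Hausdorff_config_top: "Hausdorff_space A \<Longrightarrow> Hausdorff_space (config_top G A)"
  by (simp add: config_top_def Hausdorff_space_product_topology)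

lemma compact_cantor: "compact_space cantor"
  by (simp add: cantor_def compact_space_product_topology compact_space_discrete_topology)

lemma Hausdorff_cantor: "Hausdorff_space cantor"
  by (simp add: cantor_def Hausdorff_space_product_topology)

text \<open>Over a discrete alphabet, a configuration is in the closure of \<open>X\<close> as soon
  as each of its finite windows is seen in \<open>X\<close>. This criterion makes most later
  closedness proofs combinatorial.\<close>

lemma closedin_config_discrete_iff:
  "closedin (config_top G (discrete_topology A)) X \<longleftrightarrow>
     X \<subseteq> carrier G \<rightarrow>\<^sub>E A \<and>
     (\<forall>y\<in>carrier G \<rightarrow>\<^sub>E A. (\<forall>F. finite F \<and> F \<subseteq> carrier G \<longrightarrow> (\<exists>x\<in>X. \<forall>g\<in>F. x g = y g)) \<longrightarrow> y \<in> X)"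
  (is "?L \<longleftrightarrow> ?R")
proof
  assume L: ?L
  have "y \<in> X" if y: "y \<in> carrier G \<rightarrow>\<^sub>E A"
      and F: "\<And>F. finite F \<Longrightarrow> F \<subseteq> carrier G \<Longrightarrow> \<exists>x\<in>X. \<forall>g\<in>F. x g = y g" for y
  proof (rule ccontr)
    assume "y \<notin> X"
    with L y have "openin (product_topology (\<lambda>_. discrete_topology A) (carrier G)) ((carrier G \<rightarrow>\<^sub>E A) - X)"
        "y \<in> (carrier G \<rightarrow>\<^sub>E A) - X"
      by (auto simp: closedin_def config_top_def)
    from openin_product_contains_cylinder[OF level_base_discrete this]
    obtain F where "finite F" "F \<subseteq> carrier G"
      and z: "\<And>z. z \<in> carrier G \<rightarrow>\<^sub>E A \<Longrightarrow> \<forall>i\<in>F. z i = y i \<Longrightarrow> z \<notin> X" by auto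
    then obtain x where "x \<in> X" "\<forall>g\<in>F. x g = y g" using F by blast
    moreover have "x \<in> carrier G \<rightarrow>\<^sub>E A" using closedin_subset[OF L] \<open>x \<in> X\<close> by auto
    ultimately show False using z by blast
  qed
  with closedin_subset[OF L] show ?R by simp
next
  assume R: ?R
  have "openin (config_top G (discrete_topology A)) ((carrier G \<rightarrow>\<^sub>E A) - X)"
  proof (subst openin_subopen, intro ballI)
    fix y assume y: "y \<in> (carrier G \<rightarrow>\<^sub>E A) - X"
    then obtain F where F: "finite F" "F \<subseteq> carrier G" "\<not> (\<exists>x\<in>X. \<forall>g\<in>F. x g = y g)"
      using R by (metis DiffD1 DiffD2)
    let ?T = "{z \<in> carrier G \<rightarrow>\<^sub>E A. \<forall>g\<in>F. z g = y g}"
    have "openin (config_top G (discrete_topology A)) ?T"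
      using openin_cylinder[OF level_base_discrete, of F "carrier G" y A] F y
      by (auto simp: config_top_def)
    moreover have "?T \<subseteq> (carrier G \<rightarrow>\<^sub>E A) - X" "y \<in> ?T" using F(3) y by auto
    ultimately show "\<exists>T. openin (config_top G (discrete_topology A)) T \<and> y \<in> T \<and> T \<subseteq> (carrier G \<rightarrow>\<^sub>E A) - X"
      by blast
  qed
  then show ?L using R by (auto simp: closedin_def)
qed

lemma closed_configs_limit:
  assumes "closedin (config_top G (discrete_topology A)) X" "y \<in> carrier G \<rightarrow>\<^sub>E A"
    and "\<And>F. finite F \<Longrightarrow> F \<subseteq> carrier G \<Longrightarrow> \<exists>x\<in>X. \<forall>g\<in>F. x g = y g"
  shows "y \<in> X"
  using assms unfolding closedin_config_discrete_iff by simp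

lemma closed_configsI:
  assumes "X \<subseteq> carrier G \<rightarrow>\<^sub>E A"
    and "\<And>y. y \<in> carrier G \<rightarrow>\<^sub>E A \<Longrightarrow>
      (\<And>F. finite F \<Longrightarrow> F \<subseteq> carrier G \<Longrightarrow> \<exists>x\<in>X. \<forall>g\<in>F. x g = y g) \<Longrightarrow> y \<in> X"
  shows "closedin (config_top G (discrete_topology A)) X"
  using assms unfolding closedin_config_discrete_iff by simp

lemma closed_configs_subset:
  "closedin (config_top G (discrete_topology A)) X \<Longrightarrow> X \<subseteq> carrier G \<rightarrow>\<^sub>E A"
  unfolding closedin_config_discrete_iff by simp

text \<open>Each condition concerns a single coordinate, and a window of one point already passes it
  to the limit; hence \<open>S\<close> may be infinite.\<close>

lemma closedin_pointwise_condition: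
  assumes "closedin (config_top G (discrete_topology A)) X" "S \<subseteq> carrier G"
  shows "closedin (config_top G (discrete_topology A)) {y \<in> X. \<forall>g\<in>S. P g (y g)}"
proof (rule closed_configsI)
  show "{y \<in> X. \<forall>g\<in>S. P g (y g)} \<subseteq> carrier G \<rightarrow>\<^sub>E A"
    by (rule subset_trans[OF Collect_subset closed_configs_subset[OF assms(1)]])
next
  fix y assume y: "y \<in> carrier G \<rightarrow>\<^sub>E A"
    and F: "\<And>F. finite F \<Longrightarrow> F \<subseteq> carrier G \<Longrightarrow> \<exists>x\<in>{y \<in> X. \<forall>g\<in>S. P g (y g)}. \<forall>g\<in>F. x g = y g"
  have "y \<in> X"
  proof (rule closed_configs_limit[OF assms(1) y])
    fix F assume "finite F" "F \<subseteq> carrier G"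
    from F[OF this] show "\<exists>x\<in>X. \<forall>g\<in>F. x g = y g" by blast
  qed
  moreover have "P g (y g)" if g: "g \<in> S" for g
  proof -
    obtain x where "\<forall>g\<in>S. P g (x g)" "x g = y g"
      using F[of "{g}"] g assms(2) by auto
    then show ?thesis using g by auto
  qed
  ultimately show "y \<in> {y \<in> X. \<forall>g\<in>S. P g (y g)}" by blast
qed

text \<open>Compactness in the form used by the limit arguments: gluing infinitely many pieces,
  finding limits of marker sets, bounding return times, intersecting a chain of subshifts.\<close>

lemma nested_configs_nonempty:
  assumes "finite A" "\<And>n :: nat. closedin (config_top G (discrete_topology A)) (C n)"
    and "\<And>n. C n \<noteq> {}" "decseq C"
  shows "\<exists>x. \<forall>n. x \<in> C n"
proof -
  have "(\<Inter>n. C n) \<noteq> {}"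
    using assms
    by (intro compact_space_imp_nest[OF compact_config_top])
       (auto simp: compact_space_discrete_topology)
  then show ?thesis by blast
qed

text \<open>A letterwise map commutes with the shift, and as a continuous map from a compact to a
  Hausdorff space it is closed.\<close>

lemma Sub_code:
  assumes X: "X \<in> Sub G A" and G: "group G" and f: "continuous_map A A' f"
    and "compact_space A" "Hausdorff_space A'"
  shows "code G f ` X \<in> Sub G A'"
proof -
  interpret group G by fact
  have "continuous_map (config_top G A) (config_top G A') (code G f)"
    unfolding config_top_def code_def
  proof (subst continuous_map_componentwise, intro conjI ballI)
    show "(\<lambda>x. \<lambda>g\<in>carrier G. f (x g)) ` topspace (product_topology (\<lambda>_. A) (carrier G)) \<subseteq> extensional (carrier G)"
      by auto
    fix g assume "g \<in> carrier G"
    then show "continuous_map (product_topology (\<lambda>_. A) (carrier G)) A' (\<lambda>x. (\<lambda>g\<in>carrier G. f (x g)) g)"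
      using continuous_map_compose[OF continuous_map_product_projection[of g "carrier G" "\<lambda>_. A"] f]
      by (simp add: comp_def)
  qed
  then have "closed_map (config_top G A) (config_top G A') (code G f)"
    by (intro continuous_imp_closed_map compact_config_top Hausdorff_config_top assms)
  then have "closedin (config_top G A') (code G f ` X)"
    using X by (auto simp: closed_map_def Sub_def)
  moreover have "shift G g (code G f x) = code G f (shift G g x)" if "g \<in> carrier G" for g x
    using that by (auto simp: shift_def code_def)
  ultimately show ?thesis using X by (auto simp: Sub_def)
qed

text \<open>Cylinders over finite windows at the various levels form a neighbourhood base, so an
  orbit is dense if and only if it enters all of them. The right-hand side speaks only of the images
  at each level, where Vietoris neighbourhoods are given by patterns.\<close>

lemma minimal_flow_iff_recurrent:
  assumes X: "X \<in> Sub G A" and f: "level_base A f" and D: "D \<subseteq> carrier G" and "group G"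
  shows "minimal_flow G A D X \<longleftrightarrow>
    (\<forall>F n. finite F \<and> F \<subseteq> carrier G \<longrightarrow> recurrent G D F (code G (f n) ` X))" (is "?L \<longleftrightarrow> ?R")
proof -
  interpret group G by fact
  have sub: "X \<subseteq> carrier G \<rightarrow>\<^sub>E topspace A"
    using closedin_subset[of "config_top G A" X] X by (simp add: Sub_def)
  have inv: "shift G g x \<in> X" if "x \<in> X" "g \<in> D" for x g
    using X that D by (auto simp: Sub_def)
  have rec: "recurrent G D F (code G (f n) ` X) \<longleftrightarrow>
      (\<forall>x\<in>X. \<forall>y\<in>X. \<exists>d\<in>D. \<forall>g\<in>F. f n (shift G d x g) = f n (y g))" if "F \<subseteq> carrier G" for F n
    unfolding recurrent_def using that D by (simp add: code_def shift_def subset_iff)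
  show ?thesis
  proof
    assume L: ?L
    show ?R
    proof (intro allI impI, subst rec, simp, intro ballI)
      fix F n x y assume F: "finite F \<and> F \<subseteq> carrier G" and x: "x \<in> X" and y: "y \<in> X"
      let ?T = "{z \<in> carrier G \<rightarrow>\<^sub>E topspace A. \<forall>g\<in>F. f n (z g) = f n (y g)}"
      have yA: "y g \<in> topspace A" if "g \<in> F" for g
      proof -
        have "y \<in> carrier G \<rightarrow>\<^sub>E topspace A" using sub y by (rule subsetD)
        then show ?thesis using F that by (auto simp: PiE_iff)
      qed
      have "openin (config_top G A) ?T"
        unfolding config_top_def by (intro openin_cylinder f) (use F yA in auto)
      then have op: "openin (subtopology (config_top G A) X) (?T \<inter> X)"
        unfolding openin_subtopology by blast
      have yT: "y \<in> ?T \<inter> X" using y subsetD[OF sub y] by simp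
      have "y \<in> subtopology (config_top G A) X closure_of ((\<lambda>g. shift G g x) ` D)"
        using L x y by (simp add: minimal_flow_def)
      then have "\<exists>z. z \<in> (\<lambda>g. shift G g x) ` D \<and> z \<in> ?T \<inter> X"
        using op yT unfolding in_closure_of by (elim conjE allE[of _ "?T \<inter> X"] impE) (rule conjI)
      then obtain d where "d \<in> D" "shift G d x \<in> ?T \<inter> X"
        by blast
      then show "\<exists>d\<in>D. \<forall>g\<in>F. f n (shift G d x g) = f n (y g)"
        by blast
    qed
  next
    assume R: ?R
    have "subtopology (config_top G A) X closure_of ((\<lambda>g. shift G g x) ` D) = X" if x: "x \<in> X" for x
    proof
      show "subtopology (config_top G A) X closure_of ((\<lambda>g. shift G g x) ` D) \<subseteq> X"
        using closure_of_subset_topspace[of "subtopology (config_top G A) X" "(\<lambda>g. shift G g x) ` D"]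
        by simp
      show "X \<subseteq> subtopology (config_top G A) X closure_of ((\<lambda>g. shift G g x) ` D)"
      proof
        fix y assume y: "y \<in> X"
        have "\<exists>d\<in>D. shift G d x \<in> T" if T: "y \<in> T" "openin (subtopology (config_top G A) X) T" for T
        proof -
          obtain T' where T': "openin (config_top G A) T'" "T = T' \<inter> X"
            using T(2) by (auto simp: openin_subtopology)
          then obtain F n where F: "finite F" "F \<subseteq> carrier G"
              "\<forall>z\<in>carrier G \<rightarrow>\<^sub>E topspace A. (\<forall>i\<in>F. f n (z i) = f n (y i)) \<longrightarrow> z \<in> T'"
            using openin_product_contains_cylinder[OF f, of "carrier G" T' y] T(1)
            by (auto simp: config_top_def)
          have "recurrent G D F (code G (f n) ` X)"
            using R F(1,2) by simp
          then obtain d where d: "d \<in> D" "\<forall>g\<in>F. f n (shift G d x g) = f n (y g)"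
            using rec[OF F(2)] x y by metis
          then have "shift G d x \<in> T'" using bspec[OF F(3)] subsetD[OF sub inv[OF x d(1)]] by simp
          then show ?thesis using inv[OF x d(1)] d(1) T'(2) by auto
        qed
        then show "y \<in> subtopology (config_top G A) X closure_of ((\<lambda>g. shift G g x) ` D)"
          unfolding in_closure_of using y subsetD[OF sub y] by auto
      qed
    qed
    then show ?L by (simp add: minimal_flow_def)
  qed
qed

subsection \<open>Gluing and maximal spaced sets\<close>

lemma restrict_eq_iff: "restrict x S = restrict y S \<longleftrightarrow> (\<forall>g\<in>S. x g = y g)"
  by (auto simp: restrict_def fun_eq_iff)

lemma apart_iff: "apart G U S T \<longleftrightarrow> (\<forall>u\<in>U. \<forall>s\<in>S. \<forall>t\<in>T. u \<otimes>\<^bsub>G\<^esub> s \<noteq> t \<and> u \<otimes>\<^bsub>G\<^esub> t \<noteq> s)"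
  by (auto simp: apart_def set_mult_def)

text \<open>The window \<open>U\<close> is a parameter, since both the UFO and the window of the
  refined subshift are built from it.\<close>

definition gluing :: "('a, 'b) monoid_scheme \<Rightarrow> 'a set \<Rightarrow> ('a \<Rightarrow> 'c) set \<Rightarrow> bool" where
  "gluing G U X \<longleftrightarrow> (\<forall>x\<^sub>0\<in>X. \<forall>x\<^sub>1\<in>X. \<forall>S\<^sub>0 S\<^sub>1.
     S\<^sub>0 \<subseteq> carrier G \<and> S\<^sub>1 \<subseteq> carrier G \<and> apart G U S\<^sub>0 S\<^sub>1 \<longrightarrow>
     (\<exists>y\<in>X. (\<forall>g\<in>S\<^sub>0. y g = x\<^sub>0 g) \<and> (\<forall>g\<in>S\<^sub>1. y g = x\<^sub>1 g)))"

lemma strongly_irreducible_fin_iff: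
  "strongly_irreducible_fin G A X \<longleftrightarrow>
     X \<in> Sub_fin G A \<and> (\<exists>U. finite U \<and> U \<subseteq> carrier G \<and> gluing G U X)"
  by (simp add: strongly_irreducible_fin_def gluing_def restrict_eq_iff)

lemma gluingD:
  assumes "gluing G U X" "x\<^sub>0 \<in> X" "x\<^sub>1 \<in> X" "S\<^sub>0 \<subseteq> carrier G" "S\<^sub>1 \<subseteq> carrier G" "apart G U S\<^sub>0 S\<^sub>1"
  obtains y where "y \<in> X" "\<And>g. g \<in> S\<^sub>0 \<Longrightarrow> y g = x\<^sub>0 g" "\<And>g. g \<in> S\<^sub>1 \<Longrightarrow> y g = x\<^sub>1 g"
  using assms unfolding gluing_def by metis

text \<open>Apartness from each member of a family gives apartness from its union, so the pieces can
  be added one at a time.\<close>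

lemma glue_finite:
  assumes "gluing G U X" "X \<noteq> {}" "finite I"
    and "\<And>i. i \<in> I \<Longrightarrow> S i \<subseteq> carrier G" "\<And>i. i \<in> I \<Longrightarrow> x i \<in> X"
    and "pairwise (\<lambda>i j. apart G U (S i) (S j)) I"
  shows "\<exists>y\<in>X. \<forall>i\<in>I. \<forall>g\<in>S i. y g = x i g"
  using assms(3-6)
proof (induction I)
  case empty
  then show ?case using assms(2) by blast
next
  case (insert i I)
  then obtain y where y: "y \<in> X" "\<forall>j\<in>I. \<forall>g\<in>S j. y g = x j g"
    by (auto simp: pairwise_insert)
  have "apart G U (\<Union>j\<in>I. S j) (S i)"
    using insert.prems(3) insert.hyps(2) by (fastforce simp: pairwise_insert apart_iff)
  moreover have "(\<Union>j\<in>I. S j) \<subseteq> carrier G" "S i \<subseteq> carrier G" "x i \<in> X"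
    using insert.prems by auto
  ultimately obtain w where "w \<in> X" "\<And>g. g \<in> (\<Union>j\<in>I. S j) \<Longrightarrow> w g = y g" "\<And>g. g \<in> S i \<Longrightarrow> w g = x i g"
    using gluingD[OF assms(1) y(1)] by metis
  then have "\<forall>j\<in>insert i I. \<forall>g\<in>S j. w g = x j g"
    using y(2) by (metis UN_I insert_iff)
  then show ?case using \<open>w \<in> X\<close> by blast
qed

text \<open>The configurations in \<open>X\<close> that realise the first \<open>n\<close> pieces
  form a decreasing sequence of nonempty closed sets.\<close>

lemma glue_countable:
  assumes "gluing G U X" "X \<noteq> {}" "countable I" "finite A"
    and "closedin (config_top G (discrete_topology A)) X"
    and "\<And>i. i \<in> I \<Longrightarrow> S i \<subseteq> carrier G" "\<And>i. i \<in> I \<Longrightarrow> x i \<in> X"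
    and "pairwise (\<lambda>i j. apart G U (S i) (S j)) I"
  shows "\<exists>y\<in>X. \<forall>i\<in>I. \<forall>g\<in>S i. y g = x i g"
proof (cases "I = {}")
  case True
  then show ?thesis using assms(2) by blast
next
  case False
  then obtain e :: "nat \<Rightarrow> _" where e: "I = range e"
    using uncountable_def assms(3) by metis
  \<comment> \<open>The quantifier over \<open>g\<close> comes first so that this is a condition on
    single values, as \<open>closedin_pointwise_condition\<close> requires.\<close>
  define C where "C n = {y \<in> X. \<forall>g\<in>carrier G. \<forall>k<n. g \<in> S (e k) \<longrightarrow> y g = x (e k) g}" for n
  have "\<exists>y. \<forall>n. y \<in> C n"
  proof (rule nested_configs_nonempty[OF assms(4)])
    show "closedin (config_top G (discrete_topology A)) (C n)" for n
      unfolding C_def by (rule closedin_pointwise_condition[OF assms(5)]) simp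
    show "C n \<noteq> {}" for n
    proof -
      have "\<exists>y\<in>X. \<forall>i\<in>e ` {..<n}. \<forall>g\<in>S i. y g = x i g"
        using assms(6,7) e pairwise_subset[OF assms(8), of "e ` {..<n}"]
        by (intro glue_finite[OF assms(1,2)]) auto
      then show ?thesis unfolding C_def by auto
    qed
    show "decseq C" unfolding C_def decseq_def by auto
  qed
  then obtain y where y: "\<And>n. y \<in> C n" by blast
  have "y \<in> X" using y[of 0] by (simp add: C_def)
  moreover have "y g = x (e k) g" if "g \<in> S (e k)" for k g
    using y[of "Suc k"] that assms(6)[of "e k"] e unfolding C_def by auto
  ultimately show ?thesis using e by auto
qed

section \<open>Maximal spaced sets\<close>

lemma spaced_iff:
  "spaced G V S \<longleftrightarrow> S \<subseteq> carrier G \<and> (\<forall>g\<in>S. \<forall>h\<in>S. g \<noteq> h \<longrightarrow> (\<forall>v\<in>V. h \<noteq> v \<otimes>\<^bsub>G\<^esub> g))"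
  by (auto simp: spaced_def r_coset_def)

text \<open>Maximality becomes local: every point outside is blocked by a point of \<open>M\<close>,
  in one of two orders because \<open>V\<close> need not be symmetric. In a group, a finite
  \<open>V\<close> leaves each point only finitely many potential blockers.\<close>

lemma maximal_spaced_iff:
  "maximal_spaced G V M \<longleftrightarrow> spaced G V M \<and>
     (\<forall>h\<in>carrier G. h \<notin> M \<longrightarrow> (\<exists>m\<in>M. \<exists>v\<in>V. h = v \<otimes>\<^bsub>G\<^esub> m \<or> m = v \<otimes>\<^bsub>G\<^esub> h))" (is "_ \<longleftrightarrow> _ \<and> ?R")
proof
  assume L: "maximal_spaced G V M"
  have ?R
  proof (intro ballI impI, rule ccontr)
    fix h assume h: "h \<in> carrier G" "h \<notin> M" "\<not> (\<exists>m\<in>M. \<exists>v\<in>V. h = v \<otimes>\<^bsub>G\<^esub> m \<or> m = v \<otimes>\<^bsub>G\<^esub> h)"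
    then have "spaced G V (insert h M)"
      using L unfolding maximal_spaced_def spaced_iff by blast
    then show False using L h(2) unfolding maximal_spaced_def by blast
  qed
  then show "spaced G V M \<and> ?R" using L by (simp add: maximal_spaced_def)
next
  assume R: "spaced G V M \<and> ?R"
  have "S = M" if S: "spaced G V S" "M \<subseteq> S" for S
  proof (rule ccontr)
    assume "S \<noteq> M"
    then obtain h where h: "h \<in> S" "h \<notin> M" using S(2) by blast
    moreover have "h \<in> carrier G" using S(1) h(1) unfolding spaced_iff by blast
    ultimately obtain m v where m: "m \<in> M" "v \<in> V" "h = v \<otimes>\<^bsub>G\<^esub> m \<or> m = v \<otimes>\<^bsub>G\<^esub> h"
      using R by blast
    moreover have "m \<in> S" "m \<noteq> h" using m(1) S(2) h(2) by blast+
    ultimately show False using S(1) h(1) unfolding spaced_iff by metis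
  qed
  then show "maximal_spaced G V M" using R unfolding maximal_spaced_def by simp
qed

lemma spaced_extends_to_maximal:
  assumes "spaced G V M"
  shows "\<exists>M'. M \<subseteq> M' \<and> maximal_spaced G V M'"
proof -
  let ?\<A> = "{S. spaced G V S \<and> M \<subseteq> S}"
  have "\<exists>N\<in>?\<A>. \<forall>S\<in>?\<A>. N \<subseteq> S \<longrightarrow> S = N"
  proof (rule subset_Zorn_nonempty)
    show "?\<A> \<noteq> {}" using assms by blast
  next
    fix \<C> assume C: "\<C> \<noteq> {}" "subset.chain ?\<A> \<C>"
    have sp: "spaced G V S" if "S \<in> \<C>" for S using C(2) that by (auto simp: subset.chain_def)
    have "v \<otimes>\<^bsub>G\<^esub> g \<noteq> h" if "g \<in> S" "h \<in> T" "S \<in> \<C>" "T \<in> \<C>" "g \<noteq> h" "v \<in> V" for g h S T v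
    proof -
      have "S \<subseteq> T \<or> T \<subseteq> S" using C(2) that by (auto simp: subset_chain_def)
      then show ?thesis using that sp[of S] sp[of T] unfolding spaced_iff by blast
    qed
    then have "spaced G V (\<Union>\<C>)" using sp unfolding spaced_iff by blast
    moreover obtain S where "S \<in> \<C>" "M \<subseteq> S" using C by (auto simp: subset.chain_def)
    ultimately show "\<Union>\<C> \<in> ?\<A>" by blast
  qed
  then obtain N where N: "spaced G V N" "M \<subseteq> N" and max: "\<forall>S\<in>?\<A>. N \<subseteq> S \<longrightarrow> S = N"
    by blast
  have "S = N" if "spaced G V S \<and> N \<subseteq> S" for S
    using max N(2) that by blast
  then have "maximal_spaced G V N" using N(1) unfolding maximal_spaced_def by simp
  then show ?thesis using N(2) by blast
qed

context group
begin

text \<open>Spacedness relates points by left multiplication with \<open>V\<close>, which commutes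
  with right translation.\<close>

lemma maximal_spaced_translate:
  assumes "maximal_spaced G V M" "V \<subseteq> carrier G" "g \<in> carrier G"
  shows "maximal_spaced G V ((\<lambda>m. m \<otimes> g) ` M)"
proof -
  have M: "M \<subseteq> carrier G" "\<And>m m' v. m \<in> M \<Longrightarrow> m' \<in> M \<Longrightarrow> m \<noteq> m' \<Longrightarrow> v \<in> V \<Longrightarrow> m' \<noteq> v \<otimes> m"
      "\<And>h. h \<in> carrier G \<Longrightarrow> h \<notin> M \<Longrightarrow> \<exists>m\<in>M. \<exists>v\<in>V. h = v \<otimes> m \<or> m = v \<otimes> h"
    using assms(1) unfolding maximal_spaced_iff spaced_iff by simp_all
  have eq: "v \<otimes> (m \<otimes> g) = m' \<otimes> g \<longleftrightarrow> v \<otimes> m = m'"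
    if "v \<in> V" "m \<in> carrier G" "m' \<in> carrier G" for v m m'
    using that assms(2,3) by (simp add: m_assoc[symmetric] subset_iff)
  have "spaced G V ((\<lambda>m. m \<otimes> g) ` M)"
    unfolding spaced_iff
  proof (intro conjI ballI impI)
    show "(\<lambda>m. m \<otimes> g) ` M \<subseteq> carrier G" using M(1) assms(3) by auto
    fix a b v assume "a \<in> (\<lambda>m. m \<otimes> g) ` M" "b \<in> (\<lambda>m. m \<otimes> g) ` M" "a \<noteq> b" "v \<in> V"
    then obtain m m' where m: "m \<in> M" "m' \<in> M" "m \<noteq> m'" "a = m \<otimes> g" "b = m' \<otimes> g" by auto
    then show "b \<noteq> v \<otimes> a"
      using M(2)[OF m(1-3) \<open>v \<in> V\<close>] eq[OF \<open>v \<in> V\<close>, of m m'] M(1) by (metis subsetD)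
  qed
  moreover have "\<exists>m\<in>(\<lambda>m. m \<otimes> g) ` M. \<exists>v\<in>V. h = v \<otimes> m \<or> m = v \<otimes> h"
    if h: "h \<in> carrier G" "h \<notin> (\<lambda>m. m \<otimes> g) ` M" for h
  proof -
    define k where "k = h \<otimes> inv g"
    have k: "k \<in> carrier G" "h = k \<otimes> g"
      using h(1) assms(3) by (auto simp: k_def m_assoc)
    then have "k \<notin> M" using h(2) by blast
    then obtain m v where m: "m \<in> M" "v \<in> V" "k = v \<otimes> m \<or> m = v \<otimes> k" using M(3) k(1) by blast
    then have "h = v \<otimes> (m \<otimes> g) \<or> m \<otimes> g = v \<otimes> h"
      using eq[of v m k] eq[of v k m] k M(1) by auto
    then show ?thesis using m by blast
  qed
  ultimately show ?thesis unfolding maximal_spaced_iff by blast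
qed

lemma UFO_meets_subgroup:
  assumes "UFO G D V" "subgroup D G" "maximal_spaced G V M"
  shows "\<exists>m\<in>M. m \<in> D"
proof -
  have "D \<subseteq> carrier G" using assms(2) by (rule subgroup.subset)
  then have "D #> \<one> = D" by (rule coset_mult_one)
  then have "D \<in> rcosets D" unfolding RCOSETS_def by auto
  then show ?thesis using assms(1,3) unfolding UFO_def by blast
qed

text \<open>Subsets are encoded as configurations over \<open>bool\<close>, so that compactness of
  configuration spaces also yields limits of marker sets.\<close>

lemma closedin_maximal_spaced:
  assumes "finite V" "V \<subseteq> carrier G"
  shows "closedin (config_top G (discrete_topology UNIV))
    {\<phi> \<in> carrier G \<rightarrow>\<^sub>E UNIV. maximal_spaced G V {g \<in> carrier G. \<phi> g}}"
proof (rule closed_configsI)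
  show "{\<phi> \<in> carrier G \<rightarrow>\<^sub>E UNIV. maximal_spaced G V {g \<in> carrier G. \<phi> g}} \<subseteq> carrier G \<rightarrow>\<^sub>E UNIV"
    by (rule Collect_subset)
next
  fix y :: "'a \<Rightarrow> bool"
  assume y: "y \<in> carrier G \<rightarrow>\<^sub>E UNIV"
    and F: "\<And>F. finite F \<Longrightarrow> F \<subseteq> carrier G \<Longrightarrow>
      \<exists>x\<in>{\<phi> \<in> carrier G \<rightarrow>\<^sub>E UNIV. maximal_spaced G V {g \<in> carrier G. \<phi> g}}. \<forall>g\<in>F. x g = y g"
  have approx: "\<exists>x. maximal_spaced G V {g \<in> carrier G. x g} \<and> (\<forall>g\<in>F. x g = y g)"
    if "finite F" "F \<subseteq> carrier G" for F
    using F[OF that] by auto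
  have "spaced G V {g \<in> carrier G. y g}"
    unfolding spaced_iff
  proof (intro conjI ballI impI)
    fix g h v assume gh: "g \<in> {g \<in> carrier G. y g}" "h \<in> {g \<in> carrier G. y g}" "g \<noteq> h" "v \<in> V"
    then obtain x where "maximal_spaced G V {g \<in> carrier G. x g}" "\<forall>k\<in>{g, h}. x k = y k"
      using approx[of "{g, h}"] by auto
    then show "h \<noteq> v \<otimes> g"
      using gh unfolding maximal_spaced_def spaced_iff by auto
  qed auto
  moreover have "\<exists>m\<in>{g \<in> carrier G. y g}. \<exists>v\<in>V. h = v \<otimes> m \<or> m = v \<otimes> h"
    if h: "h \<in> carrier G" "h \<notin> {g \<in> carrier G. y g}" for h
  proof -
    \<comment> \<open>The point itself and all its potential blockers: agreement there carries the
      blocking of \<open>h\<close> over from \<open>x\<close> to \<open>y\<close>.\<close>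
    let ?F = "insert h ((\<lambda>v. v \<otimes> h) ` V \<union> (\<lambda>v. inv v \<otimes> h) ` V)"
    have "finite ?F" "?F \<subseteq> carrier G" using assms h by auto
    from approx[OF this] obtain x where x: "maximal_spaced G V {g \<in> carrier G. x g}" "\<forall>g\<in>?F. x g = y g"
      by auto
    then obtain m v where m: "m \<in> carrier G" "x m" "v \<in> V" "h = v \<otimes> m \<or> m = v \<otimes> h"
      using h unfolding maximal_spaced_iff by auto
    then have "m \<in> ?F"
      using assms(2) by (auto simp: m_assoc[symmetric] subset_iff image_iff intro!: bexI[of _ v])
    then have "y m" using m(2) x(2) by auto
    then show ?thesis using m by blast
  qed
  ultimately have "maximal_spaced G V {g \<in> carrier G. y g}"
    unfolding maximal_spaced_iff by blast
  then show "y \<in> {\<phi> \<in> carrier G \<rightarrow>\<^sub>E UNIV. maximal_spaced G V {g \<in> carrier G. \<phi> g}}"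
    using y by simp
qed

section \<open>Subshifts with marked windows\<close>

definition marked :: "('a \<Rightarrow> 'c) set \<Rightarrow> 'a set \<Rightarrow> 'a set \<Rightarrow> ('a \<Rightarrow> 'c) \<Rightarrow> ('a \<Rightarrow> 'c) set" where
  "marked X V B z = {y \<in> X. \<exists>M. maximal_spaced G V M \<and> (\<forall>m\<in>M. \<forall>b\<in>B. y (b \<otimes> m) = z b)}"

lemma marked_subset: "marked X V B z \<subseteq> X"
  by (auto simp: marked_def)

text \<open>The marker set is not recorded in the configuration, so a limit \<open>y\<close> of
  marked configurations does not come with one. The sets compatible with \<open>y\<close> on an
  initial part of the group are nested, closed and nonempty, and a common element is a marker set
  for \<open>y\<close>.\<close>

lemma closedin_marked:
  assumes "countable (carrier G)" "closedin (config_top G (discrete_topology A)) X"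
    and V: "finite V" "V \<subseteq> carrier G" and B: "finite B" "B \<subseteq> carrier G"
  shows "closedin (config_top G (discrete_topology A)) (marked X V B z)"
proof (rule closed_configsI)
  show "marked X V B z \<subseteq> carrier G \<rightarrow>\<^sub>E A"
    using marked_subset closed_configs_subset[OF assms(2)] by (rule subset_trans)
next
  fix y assume y: "y \<in> carrier G \<rightarrow>\<^sub>E A"
    and F: "\<And>F. finite F \<Longrightarrow> F \<subseteq> carrier G \<Longrightarrow> \<exists>x\<in>marked X V B z. \<forall>g\<in>F. x g = y g"
  have "y \<in> X"
  proof (rule closed_configs_limit[OF assms(2) y])
    fix F assume "finite F" "F \<subseteq> carrier G"
    from F[OF this] show "\<exists>x\<in>X. \<forall>g\<in>F. x g = y g" by (auto simp: marked_def)
  qed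
  obtain e :: "nat \<Rightarrow> 'a" where e: "carrier G = range e"
    using uncountable_def assms(1) by (metis carrier_not_empty)
  define MS where "MS = {\<phi> \<in> carrier G \<rightarrow>\<^sub>E (UNIV :: bool set). maximal_spaced G V {g \<in> carrier G. \<phi> g}}"
  define C where "C n = {\<phi> \<in> MS. \<forall>g\<in>e ` {..<n}. \<phi> g \<longrightarrow> (\<forall>b\<in>B. y (b \<otimes> g) = z b)}" for n
  have "\<exists>\<phi>. \<forall>n. \<phi> \<in> C n"
  proof (rule nested_configs_nonempty)
    show "closedin (config_top G (discrete_topology UNIV)) (C n)" for n
      unfolding C_def MS_def by (rule closedin_pointwise_condition[OF closedin_maximal_spaced[OF V]]) (use e in auto)
    show "decseq C" unfolding C_def decseq_def by auto
    show "C n \<noteq> {}" for n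
    proof -
      \<comment> \<open>A marked configuration that agrees with \<open>y\<close> on this window
        shows \<open>z\<close> at those of its markers that are among the first \<open>n\<close>
        points; hence so does \<open>y\<close>.\<close>
      let ?F = "(\<lambda>(b, g). b \<otimes> g) ` (B \<times> e ` {..<n})"
      have "e k \<in> carrier G" for k using e by simp
      then have "finite ?F" "?F \<subseteq> carrier G" using B by auto
      from F[OF this] obtain x where x: "x \<in> marked X V B z" "\<And>g. g \<in> ?F \<Longrightarrow> x g = y g" by blast
      from x(1) obtain M where M: "maximal_spaced G V M" "\<forall>m\<in>M. \<forall>b\<in>B. x (b \<otimes> m) = z b"
        unfolding marked_def by blast
      have "M \<subseteq> carrier G" using M(1) by (simp add: maximal_spaced_iff spaced_iff)
      then have "{g \<in> carrier G. (\<lambda>g\<in>carrier G. g \<in> M) g} = M" by auto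
      then have "(\<lambda>g\<in>carrier G. g \<in> M) \<in> MS" using M(1) by (simp add: MS_def)
      moreover have "y (b \<otimes> g) = z b" if "g \<in> e ` {..<n}" "g \<in> M" "b \<in> B" for g b
      proof -
        have "b \<otimes> g \<in> ?F" using that by auto
        then show ?thesis using x(2) M(2) that by metis
      qed
      ultimately have "(\<lambda>g\<in>carrier G. g \<in> M) \<in> C n"
        using e unfolding C_def by simp
      then show ?thesis by blast
    qed
  qed simp
  then obtain \<phi> where \<phi>: "\<And>n. \<phi> \<in> C n" by blast
  have "maximal_spaced G V {g \<in> carrier G. \<phi> g}" using \<phi>[of 0] by (simp add: C_def MS_def)
  moreover have "y (b \<otimes> m) = z b" if "m \<in> {g \<in> carrier G. \<phi> g}" "b \<in> B" for m b
  proof -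
    have "m \<in> range e" using that(1) e by simp
    then obtain k where k: "m = e k" by blast
    show ?thesis using \<phi>[of "Suc k"] that k unfolding C_def by auto
  qed
  ultimately show "y \<in> marked X V B z" using \<open>y \<in> X\<close> unfolding marked_def by blast
qed

text \<open>Shifting by \<open>g\<close> moves the markers by right multiplication with
  \<open>inv g\<close>.\<close>

lemma marked_invariant:
  assumes "X \<in> Sub_fin G A" "V \<subseteq> carrier G" "B \<subseteq> carrier G" "y \<in> marked X V B z" "g \<in> carrier G"
  shows "shift G g y \<in> marked X V B z"
proof -
  obtain M where M: "maximal_spaced G V M" "\<forall>m\<in>M. \<forall>b\<in>B. y (b \<otimes> m) = z b" and "y \<in> X"
    using assms(4) unfolding marked_def by blast
  have Mc: "M \<subseteq> carrier G" using M(1) by (simp add: maximal_spaced_iff spaced_iff)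
  have "shift G g y \<in> X" using assms(1,5) \<open>y \<in> X\<close> by (simp add: Sub_def)
  moreover have "maximal_spaced G V ((\<lambda>m. m \<otimes> inv g) ` M)"
    using maximal_spaced_translate[OF M(1) assms(2)] assms(5) by simp
  moreover have "shift G g y (b \<otimes> (m \<otimes> inv g)) = z b" if "m \<in> M" "b \<in> B" for m b
  proof -
    have "m \<in> carrier G" "b \<in> carrier G" using that Mc assms(3) by auto
    then show ?thesis using M(2) that assms(5) by (simp add: shift_def m_assoc)
  qed
  ultimately show ?thesis unfolding marked_def by blast
qed

text \<open>If \<open>u \<otimes> (b \<otimes> n) = b' \<otimes> n'\<close>, then \<open>n'\<close>
  is \<open>(inv b' \<otimes> (u \<otimes> b)) \<otimes> n\<close>, which spacedness forbids once
  that factor lies in \<open>V\<close>. This is the origin of the lower bound on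
  \<open>V\<close>.\<close>

lemma windows_apart:
  assumes M: "spaced G V M" "m \<in> M" "m' \<in> M" "m \<noteq> m'" and UB: "U \<subseteq> carrier G" "B \<subseteq> carrier G"
    and V: "\<And>u b b'. u \<in> U \<Longrightarrow> b \<in> B \<Longrightarrow> b' \<in> B \<Longrightarrow> inv b' \<otimes> (u \<otimes> b) \<in> V"
  shows "apart G U ((\<lambda>b. b \<otimes> m) ` B) ((\<lambda>b. b \<otimes> m') ` B)"
proof -
  have Mc: "M \<subseteq> carrier G" using M(1) by (simp add: spaced_iff)
  have far: "u \<otimes> (b \<otimes> n) \<noteq> b' \<otimes> n'"
    if "n \<in> M" "n' \<in> M" "n \<noteq> n'" "u \<in> U" "b \<in> B" "b' \<in> B" for u b n b' n'
  proof
    assume eq: "u \<otimes> (b \<otimes> n) = b' \<otimes> n'"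
    have c: "n \<in> carrier G" "n' \<in> carrier G" "b \<in> carrier G" "b' \<in> carrier G" "u \<in> carrier G"
      using that Mc UB by auto
    then have "n' = (inv b' \<otimes> (u \<otimes> b)) \<otimes> n"
      using eq by (metis inv_solve_left inv_closed m_closed m_assoc)
    then show False using M(1) V[of u b b'] that unfolding spaced_iff by blast
  qed
  show ?thesis unfolding apart_iff using far M(2-4) by blast
qed

lemma place_windows:
  assumes "countable (carrier G)" "finite A" "X \<in> Sub_fin G A" "gluing G U X" "z \<in> X" "spaced G V M"
    and "U \<subseteq> carrier G" "B \<subseteq> carrier G"
    and V: "\<And>u b b'. u \<in> U \<Longrightarrow> b \<in> B \<Longrightarrow> b' \<in> B \<Longrightarrow> inv b' \<otimes> (u \<otimes> b) \<in> V"
  shows "\<exists>x\<in>X. \<forall>m\<in>M. \<forall>b\<in>B. x (b \<otimes> m) = z b"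
proof -
  have Mc: "M \<subseteq> carrier G" using assms(6) by (simp add: spaced_iff)
  \<comment> \<open>\<open>shift G (inv m) z\<close> carries the window of \<open>z\<close> from
    \<open>B\<close> to its translate at \<open>m\<close>.\<close>
  have "\<exists>y\<in>X. \<forall>m\<in>M. \<forall>g\<in>(\<lambda>b. b \<otimes> m) ` B. y g = shift G (inv m) z g"
  proof (rule glue_countable[OF assms(4)])
    show "X \<noteq> {}" "closedin (config_top G (discrete_topology A)) X" using assms(3) by (auto simp: Sub_def)
    show "countable M" using countable_subset[OF Mc assms(1)] .
    show "finite A" by fact
    show "(\<lambda>b. b \<otimes> m) ` B \<subseteq> carrier G" if "m \<in> M" for m using that Mc assms(8) by auto
    show "shift G (inv m) z \<in> X" if "m \<in> M" for m
      using that Mc assms(3,5) by (auto simp: Sub_def)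
    show "pairwise (\<lambda>i j. apart G U ((\<lambda>b. b \<otimes> i) ` B) ((\<lambda>b. b \<otimes> j) ` B)) M"
      unfolding pairwise_def using windows_apart[OF assms(6) _ _ _ assms(7,8) V] by simp
  qed
  then obtain y where y: "y \<in> X" "\<forall>m\<in>M. \<forall>g\<in>(\<lambda>b. b \<otimes> m) ` B. y g = shift G (inv m) z g" by blast
  have "y (b \<otimes> m) = z b" if "m \<in> M" "b \<in> B" for m b
  proof -
    have "m \<in> carrier G" "b \<in> carrier G" using that Mc assms(8) by auto
    then show ?thesis using y(2) that by (simp add: shift_def m_assoc)
  qed
  then show ?thesis using y(1) by blast
qed


lemma mem_set_mult_iff: "x \<in> K <#> S \<longleftrightarrow> (\<exists>k\<in>K. \<exists>s\<in>S. x = k \<otimes> s)"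
  by (auto simp: set_mult_def)

text \<open>The markers are spliced before the values. The new window \<open>W\<close> only has to
  keep the two kept parts of the marker sets from interfering; the values are then glued in
  \<open>X\<close> with the old window \<open>U\<close>.\<close>

lemma marked_gluing:
  assumes cnt: "countable (carrier G)" and A: "finite A" and X: "X \<in> Sub_fin G A" and gl: "gluing G U X"
    and z: "z \<in> X" and U: "finite U" "U \<subseteq> carrier G" and V: "finite V" "V \<subseteq> carrier G"
    and B: "finite B" "B \<subseteq> carrier G"
    and UV: "\<And>u b b'. u \<in> U \<Longrightarrow> b \<in> B \<Longrightarrow> b' \<in> B \<Longrightarrow> inv b' \<otimes> (u \<otimes> b) \<in> V"
  shows "\<exists>W. finite W \<and> W \<subseteq> carrier G \<and> gluing G W (marked X V B z)"
proof -
  \<comment> \<open>\<open>K1 <#> S\<close> contains the markers whose windows are not \<open>U\<close>-apart from \<open>S\<close>, and \<open>K2 <#> S\<close> also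
    the markers that block a point of \<open>K1 <#> S\<close> from being one.\<close>
  define K1 where "K1 = (\<lambda>(b, u). inv b \<otimes> u) ` (B \<times> U) \<union> (\<lambda>(b, u). inv b \<otimes> inv u) ` (B \<times> U)"
  define K2 where "K2 = K1 \<union> (\<lambda>(v, k). v \<otimes> k) ` (V \<times> K1) \<union> (\<lambda>(v, k). inv v \<otimes> k) ` (V \<times> K1)"
  \<comment> \<open>\<open>U\<close> keeps the two prescribed sets apart for gluing in
    \<open>X\<close>; the other parts make their \<open>K2\<close>-neighbourhoods disjoint and
    forbid a \<open>V\<close>-step from one to the other.\<close>
  define W where "W = U \<union> (\<lambda>(k', k). inv k' \<otimes> k) ` (K2 \<times> K2)
    \<union> (\<lambda>(k', v, k). inv k' \<otimes> (v \<otimes> k)) ` (K2 \<times> V \<times> K2)"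
  have K1: "finite K1" "K1 \<subseteq> carrier G"
    using U B by (auto simp: K1_def)
  have K2: "finite K2" "K2 \<subseteq> carrier G"
    using K1 V by (auto simp: K2_def)
  have W: "finite W" "W \<subseteq> carrier G"
    using K2 U V by (auto simp: W_def intro!: m_closed inv_closed)
  have K12: "K1 \<subseteq> K2" by (auto simp: K2_def)
  have K1I: "inv b \<otimes> u \<in> K1" "inv b \<otimes> inv u \<in> K1" if "b \<in> B" "u \<in> U" for b u
    using that by (auto simp: K1_def)
  have K2I: "v \<otimes> k \<in> K2" "inv v \<otimes> k \<in> K2" if "v \<in> V" "k \<in> K1" for v k
    using that by (auto simp: K2_def)
  have WI: "inv k' \<otimes> k \<in> W" "v \<in> V \<Longrightarrow> inv k' \<otimes> (v \<otimes> k) \<in> W" if "k' \<in> K2" "k \<in> K2" for k k' v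
    using that by (force simp: W_def)+
  have window: "m \<in> K1 <#> S"
    if "m \<in> carrier G" "b \<in> B" "u \<in> U" "s \<in> S" "S \<subseteq> carrier G" "u \<otimes> (b \<otimes> m) = s \<or> u \<otimes> s = b \<otimes> m"
    for S m b u s
  proof -
    have c: "b \<in> carrier G" "u \<in> carrier G" "s \<in> carrier G" using that U(2) B(2) by auto
    from that(6) have "m = (inv b \<otimes> inv u) \<otimes> s \<or> m = (inv b \<otimes> u) \<otimes> s"
    proof
      assume "u \<otimes> (b \<otimes> m) = s"
      then have "b \<otimes> m = inv u \<otimes> s" using c that(1) by (metis inv_solve_left m_closed)
      then have "m = inv b \<otimes> (inv u \<otimes> s)" using c that(1) by (metis inv_solve_left inv_closed m_closed)
      then show ?thesis using c by (simp add: m_assoc)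
    next
      assume "u \<otimes> s = b \<otimes> m"
      then have "m = inv b \<otimes> (u \<otimes> s)" using c that(1) by (metis inv_solve_left m_closed)
      then show ?thesis using c by (simp add: m_assoc)
    qed
    then show ?thesis unfolding mem_set_mult_iff using that(2-4) K1I by blast
  qed
  have near: "m' \<in> K2 <#> S"
    if h: "m \<in> K1 <#> S" "S \<subseteq> carrier G" "m' \<in> carrier G" "v \<in> V" "m = v \<otimes> m' \<or> m' = v \<otimes> m"
    for S m m' v
  proof -
    obtain k s where ks: "k \<in> K1" "s \<in> S" "m = k \<otimes> s" using h(1) unfolding mem_set_mult_iff by blast
    have c: "k \<in> carrier G" "s \<in> carrier G" "v \<in> carrier G" using ks K1(2) h V(2) by auto
    from h(5) have "m' = (inv v \<otimes> k) \<otimes> s \<or> m' = (v \<otimes> k) \<otimes> s"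
    proof
      assume "m = v \<otimes> m'"
      then have "m' = inv v \<otimes> m" using c h(3) ks by (metis inv_solve_left m_closed)
      then show ?thesis using c ks by (simp add: m_assoc)
    next
      assume "m' = v \<otimes> m"
      then show ?thesis using c ks by (simp add: m_assoc)
    qed
    then show ?thesis unfolding mem_set_mult_iff using ks(1,2) h(4) K2I by blast
  qed
  have separated: "m\<^sub>0 \<noteq> m\<^sub>1 \<and> (\<forall>v\<in>V. v \<otimes> m\<^sub>0 \<noteq> m\<^sub>1)"
    if h: "apart G W S T" "S \<subseteq> carrier G" "T \<subseteq> carrier G" "m\<^sub>0 \<in> K2 <#> S" "m\<^sub>1 \<in> K2 <#> T"
    for S T m\<^sub>0 m\<^sub>1
  proof -
    obtain k s where ks: "k \<in> K2" "s \<in> S" "m\<^sub>0 = k \<otimes> s" using h(4) unfolding mem_set_mult_iff by blast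
    obtain k' t where kt: "k' \<in> K2" "t \<in> T" "m\<^sub>1 = k' \<otimes> t" using h(5) unfolding mem_set_mult_iff by blast
    have c: "k \<in> carrier G" "k' \<in> carrier G" "s \<in> carrier G" "t \<in> carrier G" using ks kt K2(2) h(2,3) by auto
    have no: "w \<otimes> s \<noteq> t" if "w \<in> W" for w
      using h(1) that ks(2) kt(2) unfolding apart_iff by blast
    have "m\<^sub>0 \<noteq> m\<^sub>1"
    proof
      assume "m\<^sub>0 = m\<^sub>1"
      then have "t = inv k' \<otimes> (k \<otimes> s)" using c ks(3) kt(3) by (metis inv_solve_left m_closed)
      then have "(inv k' \<otimes> k) \<otimes> s = t" using c by (simp add: m_assoc)
      moreover have "inv k' \<otimes> k \<in> W" using ks(1) kt(1) by (intro WI)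
      ultimately show False using no by blast
    qed
    moreover have "v \<otimes> m\<^sub>0 \<noteq> m\<^sub>1" if "v \<in> V" for v
    proof
      have cv: "v \<in> carrier G" using that V(2) by blast
      assume "v \<otimes> m\<^sub>0 = m\<^sub>1"
      then have "t = inv k' \<otimes> (v \<otimes> (k \<otimes> s))" using c cv ks(3) kt(3) by (metis inv_solve_left m_closed)
      then have "(inv k' \<otimes> (v \<otimes> k)) \<otimes> s = t" using c cv by (simp add: m_assoc)
      moreover have "inv k' \<otimes> (v \<otimes> k) \<in> W" using ks(1) kt(1) that by (intro WI)
      ultimately show False using no by blast
    qed
    ultimately show ?thesis by blast
  qed
  have apart_sym: "apart G W T S" if "apart G W S T" for S T
    using that unfolding apart_iff by blast
  have "gluing G W (marked X V B z)"
    unfolding gluing_def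
  proof (intro ballI allI impI, elim conjE)
    fix y\<^sub>0 y\<^sub>1 S\<^sub>0 S\<^sub>1
    assume y\<^sub>0: "y\<^sub>0 \<in> marked X V B z" and y\<^sub>1: "y\<^sub>1 \<in> marked X V B z"
      and S: "S\<^sub>0 \<subseteq> carrier G" "S\<^sub>1 \<subseteq> carrier G" and ap: "apart G W S\<^sub>0 S\<^sub>1"
    obtain M\<^sub>0 where M\<^sub>0: "y\<^sub>0 \<in> X" "maximal_spaced G V M\<^sub>0" "\<And>m b. m \<in> M\<^sub>0 \<Longrightarrow> b \<in> B \<Longrightarrow> y\<^sub>0 (b \<otimes> m) = z b"
      using y\<^sub>0 unfolding marked_def by blast
    obtain M\<^sub>1 where M\<^sub>1: "y\<^sub>1 \<in> X" "maximal_spaced G V M\<^sub>1" "\<And>m b. m \<in> M\<^sub>1 \<Longrightarrow> b \<in> B \<Longrightarrow> y\<^sub>1 (b \<otimes> m) = z b"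
      using y\<^sub>1 unfolding marked_def by blast
    \<comment> \<open>Old markers are kept on the larger neighbourhoods given by \<open>K2\<close>,
      although only those given by \<open>K1\<close> can have interfering windows: the surplus
      blocks unwanted new markers.\<close>
    define L where "L = (M\<^sub>0 \<inter> (K2 <#> S\<^sub>0)) \<union> (M\<^sub>1 \<inter> (K2 <#> S\<^sub>1))"
    have sep01: "m\<^sub>0 \<noteq> m\<^sub>1" "\<forall>v\<in>V. v \<otimes> m\<^sub>0 \<noteq> m\<^sub>1" "\<forall>v\<in>V. v \<otimes> m\<^sub>1 \<noteq> m\<^sub>0"
      if "m\<^sub>0 \<in> K2 <#> S\<^sub>0" "m\<^sub>1 \<in> K2 <#> S\<^sub>1" for m\<^sub>0 m\<^sub>1
      using separated[OF ap S that] separated[OF apart_sym[OF ap] S(2,1) that(2,1)] by blast+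
    have "spaced G V M\<^sub>0" "spaced G V M\<^sub>1"
      using M\<^sub>0(2) M\<^sub>1(2) by (simp_all add: maximal_spaced_iff)
    then have sp: "M\<^sub>0 \<subseteq> carrier G" "M\<^sub>1 \<subseteq> carrier G"
        "\<And>g h v. g \<in> M\<^sub>0 \<Longrightarrow> h \<in> M\<^sub>0 \<Longrightarrow> g \<noteq> h \<Longrightarrow> v \<in> V \<Longrightarrow> h \<noteq> v \<otimes> g"
        "\<And>g h v. g \<in> M\<^sub>1 \<Longrightarrow> h \<in> M\<^sub>1 \<Longrightarrow> g \<noteq> h \<Longrightarrow> v \<in> V \<Longrightarrow> h \<noteq> v \<otimes> g"
      unfolding spaced_iff by simp_all
    have "spaced G V L"
      unfolding spaced_iff
    proof (intro conjI ballI impI)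
      show "L \<subseteq> carrier G" using sp(1,2) unfolding L_def by blast
      fix g h v assume gh: "g \<in> L" "h \<in> L" "g \<noteq> h" "v \<in> V"
      consider "g \<in> M\<^sub>0" "h \<in> M\<^sub>0" | "g \<in> M\<^sub>1" "h \<in> M\<^sub>1" | "g \<in> K2 <#> S\<^sub>0" "h \<in> K2 <#> S\<^sub>1"
        | "g \<in> K2 <#> S\<^sub>1" "h \<in> K2 <#> S\<^sub>0"
        using gh(1,2) unfolding L_def by blast
      then show "h \<noteq> v \<otimes> g"
        using sp(3,4) sep01(2,3) gh(3,4) by cases metis+
    qed
    then obtain M where M: "L \<subseteq> M" "maximal_spaced G V M"
      using spaced_extends_to_maximal by blast
    then have Msp: "spaced G V M" by (simp add: maximal_spaced_iff)
    then have Mc: "M \<subseteq> carrier G" by (simp add: spaced_iff)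
    \<comment> \<open>Were \<open>m\<close> not in \<open>N\<close>, a point of \<open>N\<close>
      would block it by maximality; \<open>near\<close> puts that point into
      \<open>K2 <#> S\<close>, hence into \<open>L\<close> and \<open>M\<close>, against the spacing
      of \<open>M\<close>.\<close>
    have agree: "m \<in> N" if h: "m \<in> M" "m \<in> K1 <#> S" "S \<subseteq> carrier G" "maximal_spaced G V N" "N \<inter> (K2 <#> S) \<subseteq> L"
      for m S N
    proof (rule ccontr)
      assume "m \<notin> N"
      then obtain m' v where m': "m' \<in> N" "v \<in> V" "m = v \<otimes> m' \<or> m' = v \<otimes> m"
        using h(1,4) Mc unfolding maximal_spaced_iff by blast
      have "m' \<in> carrier G" using h(4) m'(1) unfolding maximal_spaced_iff spaced_iff by blast
      then have "m' \<in> M" using near[OF h(2,3) _ m'(2,3)] m'(1) h(5) M(1) by blast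
      moreover have "m \<noteq> m'" using \<open>m \<notin> N\<close> m'(1) by blast
      ultimately show False using Msp h(1) m'(2,3) unfolding spaced_iff by metis
    qed
    define Q where "Q m = (\<lambda>b. b \<otimes> m) ` B" for m
    have Q: "Q m \<subseteq> carrier G" if "m \<in> M" for m
      using that Mc B(2) by (auto simp: Q_def)
    have QQ: "apart G U (Q m) (Q m')" if "m \<in> M" "m' \<in> M" "m \<noteq> m'" for m m'
      unfolding Q_def by (rule windows_apart[OF Msp that U(2) B(2) UV])
    define R\<^sub>0 where "R\<^sub>0 = M \<inter> (K1 <#> S\<^sub>0)"
    define R\<^sub>1 where "R\<^sub>1 = M \<inter> (K1 <#> S\<^sub>1)"
    have R01: "R\<^sub>0 \<inter> R\<^sub>1 = {}"
    proof -
      have "m \<notin> K1 <#> S\<^sub>1" if "m \<in> K1 <#> S\<^sub>0" for m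
        using that K12 sep01(1)[of m m] unfolding mem_set_mult_iff by blast
      then show ?thesis unfolding R\<^sub>0_def R\<^sub>1_def by blast
    qed
    have SQ: "apart G U S (Q m)" if "m \<in> M" "m \<notin> K1 <#> S" "S \<subseteq> carrier G" for S m
      unfolding apart_iff Q_def using window[of m _ _ _ S] that Mc by blast
    have SS: "apart G U S\<^sub>0 S\<^sub>1" using ap unfolding apart_iff W_def by blast
    \<comment> \<open>Windows interfering with \<open>S\<^sub>0\<close> belong to old markers, so
      \<open>y\<^sub>0\<close> already shows \<open>z\<close> there and they are prescribed along
      with \<open>S\<^sub>0\<close>; likewise for \<open>S\<^sub>1\<close>. The windows in
      \<open>T\<close> interfere with neither set and are filled in by a second gluing.\<close>
    define T\<^sub>0 where "T\<^sub>0 = S\<^sub>0 \<union> (\<Union>m\<in>R\<^sub>0. Q m)"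
    define T\<^sub>1 where "T\<^sub>1 = S\<^sub>1 \<union> (\<Union>m\<in>R\<^sub>1. Q m)"
    define T where "T = (\<Union>m\<in>M - R\<^sub>0 - R\<^sub>1. Q m)"
    have Tc: "T\<^sub>0 \<subseteq> carrier G" "T\<^sub>1 \<subseteq> carrier G" "T \<subseteq> carrier G"
      using S Q unfolding T\<^sub>0_def T\<^sub>1_def T_def R\<^sub>0_def R\<^sub>1_def by blast+
    have apartU: "apart G U (P \<union> P') O' \<longleftrightarrow> apart G U P O' \<and> apart G U P' O'"
      "apart G U O' (P \<union> P') \<longleftrightarrow> apart G U O' P \<and> apart G U O' P'"
      "apart G U (\<Union>m\<in>J. Q m) O' \<longleftrightarrow> (\<forall>m\<in>J. apart G U (Q m) O')"
      "apart G U O' (\<Union>m\<in>J. Q m) \<longleftrightarrow> (\<forall>m\<in>J. apart G U O' (Q m))" for P P' O' J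
      unfolding apart_iff by blast+
    have sym: "apart G U P O' \<Longrightarrow> apart G U O' P" for P O'
      unfolding apart_iff by blast
    have a: "apart G U S\<^sub>0 (Q m)" if "m \<in> M - R\<^sub>0" for m
      using SQ[of m S\<^sub>0] that S(1) unfolding R\<^sub>0_def by blast
    have b: "apart G U S\<^sub>1 (Q m)" if "m \<in> M - R\<^sub>1" for m
      using SQ[of m S\<^sub>1] that S(2) unfolding R\<^sub>1_def by blast
    have RM: "R\<^sub>0 \<subseteq> M" "R\<^sub>1 \<subseteq> M" unfolding R\<^sub>0_def R\<^sub>1_def by blast+
    have "apart G U T\<^sub>0 T\<^sub>1"
      unfolding T\<^sub>0_def T\<^sub>1_def apartU
    proof (intro conjI ballI)
      show "apart G U S\<^sub>0 S\<^sub>1" by (fact SS)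
      show "apart G U S\<^sub>0 (Q m)" if "m \<in> R\<^sub>1" for m using a that R01 RM by blast
      show "apart G U (Q m) S\<^sub>1" if "m \<in> R\<^sub>0" for m using sym[OF b] that R01 RM by blast
      show "apart G U (Q m) (Q m')" if "m' \<in> R\<^sub>1" "m \<in> R\<^sub>0" for m m'
        using QQ[of m m'] that R01 RM by blast
    qed
    then obtain y where y: "y \<in> X" "\<And>g. g \<in> T\<^sub>0 \<Longrightarrow> y g = y\<^sub>0 g" "\<And>g. g \<in> T\<^sub>1 \<Longrightarrow> y g = y\<^sub>1 g"
      using gluingD[OF gl M\<^sub>0(1) M\<^sub>1(1) Tc(1,2)] by metis
    obtain x where x: "x \<in> X" "\<forall>m\<in>M. \<forall>b\<in>B. x (b \<otimes> m) = z b"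
      using place_windows[OF cnt A X gl z Msp U(2) B(2) UV] by blast
    have "apart G U (T\<^sub>0 \<union> T\<^sub>1) T"
      unfolding T\<^sub>0_def T\<^sub>1_def T_def apartU
    proof (intro conjI ballI)
      fix m assume m: "m \<in> M - R\<^sub>0 - R\<^sub>1"
      show "apart G U S\<^sub>0 (Q m)" "apart G U S\<^sub>1 (Q m)" using a b m by blast+
      show "apart G U (Q m') (Q m)" if "m' \<in> R\<^sub>0" for m' using QQ[of m' m] that m RM by blast
      show "apart G U (Q m') (Q m)" if "m' \<in> R\<^sub>1" for m' using QQ[of m' m] that m RM by blast
    qed
    then obtain w where w: "w \<in> X" "\<And>g. g \<in> T\<^sub>0 \<union> T\<^sub>1 \<Longrightarrow> w g = y g" "\<And>g. g \<in> T \<Longrightarrow> w g = x g"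
      using gluingD[OF gl y(1) x(1) _ Tc(3), of "T\<^sub>0 \<union> T\<^sub>1"] Tc by (metis Un_least)
    have "w (b \<otimes> m) = z b" if m: "m \<in> M" and b: "b \<in> B" for m b
    proof -
      have bm: "b \<otimes> m \<in> Q m" using b by (simp add: Q_def)
      consider "m \<in> R\<^sub>0" | "m \<in> R\<^sub>1" | "m \<in> M - R\<^sub>0 - R\<^sub>1" using m by blast
      then show ?thesis
      proof cases
        case 1
        then have "b \<otimes> m \<in> T\<^sub>0" using bm unfolding T\<^sub>0_def by blast
        moreover have "m \<in> M\<^sub>0"
          using agree[of m S\<^sub>0 M\<^sub>0] 1 S(1) M\<^sub>0(2) unfolding R\<^sub>0_def L_def by blast
        ultimately show ?thesis using w(2) y(2) M\<^sub>0(3) b by simp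
      next
        case 2
        then have "b \<otimes> m \<in> T\<^sub>1" using bm unfolding T\<^sub>1_def by blast
        moreover have "m \<in> M\<^sub>1"
          using agree[of m S\<^sub>1 M\<^sub>1] 2 S(2) M\<^sub>1(2) unfolding R\<^sub>1_def L_def by blast
        ultimately show ?thesis using w(2) y(3) M\<^sub>1(3) b by simp
      next
        case 3
        then have "b \<otimes> m \<in> T" using bm unfolding T_def by blast
        then show ?thesis using w(3) x(2) m b by simp
      qed
    qed
    then have "w \<in> marked X V B z" using w(1) M(2) unfolding marked_def by blast
    moreover have "\<forall>g\<in>S\<^sub>0. w g = y\<^sub>0 g" using w(2) y(2) unfolding T\<^sub>0_def by simp
    moreover have "\<forall>g\<in>S\<^sub>1. w g = y\<^sub>1 g" using w(2) y(3) unfolding T\<^sub>1_def by simp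
    ultimately show "\<exists>y\<in>marked X V B z. (\<forall>g\<in>S\<^sub>0. y g = y\<^sub>0 g) \<and> (\<forall>g\<in>S\<^sub>1. y g = y\<^sub>1 g)"
      by blast
  qed
  then show ?thesis using W by blast
qed

end

subsection \<open>Density for finite alphabets\<close>

lemma patterns_subset_iff: "patterns F X \<subseteq> patterns F Y \<longleftrightarrow> (\<forall>x\<in>X. \<exists>y\<in>Y. \<forall>g\<in>F. y g = x g)"
proof -
  have "restrict x F \<in> patterns F Y \<longleftrightarrow> (\<exists>y\<in>Y. \<forall>g\<in>F. y g = x g)" for x
    unfolding patterns_def image_iff restrict_eq_iff by (intro bex_cong refl ball_cong eq_commute)
  then show ?thesis unfolding patterns_def[of F X] image_subset_iff by simp
qed

lemma patterns_eqD:
  assumes "patterns F X = patterns F Y" "x \<in> X"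
  obtains y where "y \<in> Y" "\<And>g. g \<in> F \<Longrightarrow> y g = x g"
proof -
  have "patterns F X \<subseteq> patterns F Y" using assms(1) by simp
  then obtain y where "y \<in> Y" "\<forall>g\<in>F. y g = x g"
    using assms(2) unfolding patterns_subset_iff by blast
  then show ?thesis using that by blast
qed

lemma patterns_mono:
  assumes "patterns F' X = patterns F' Y" "F \<subseteq> F'"
  shows "patterns F X = patterns F Y"
proof -
  have "patterns F Z = (\<lambda>p. restrict p F) ` patterns F' Z" for Z :: "('a \<Rightarrow> 'b) set"
    using assms(2) by (auto simp: patterns_def image_image Int_absorb1)
  then show ?thesis using assms(1) by metis
qed

lemma finite_pattern_representatives:
  assumes "X \<subseteq> carrier G \<rightarrow>\<^sub>E A" "finite A" "finite F" "F \<subseteq> carrier G"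
  obtains R where "finite R" "R \<subseteq> X" "patterns F R = patterns F X"
proof -
  have "patterns F X \<subseteq> F \<rightarrow>\<^sub>E A"
  proof
    fix p assume "p \<in> patterns F X"
    then obtain x where x: "x \<in> X" "p = restrict x F" by (auto simp: patterns_def)
    have "x \<in> carrier G \<rightarrow>\<^sub>E A" by (rule subsetD[OF assms(1) x(1)])
    then show "p \<in> F \<rightarrow>\<^sub>E A" using x(2) assms(4) by (auto simp: PiE_iff)
  qed
  then have "finite (patterns F X)"
    using finite_subset finite_PiE[OF assms(3), of "\<lambda>_. A"] assms(2) by blast
  then obtain R where "R \<subseteq> X" "finite R" "patterns F X = (\<lambda>x. restrict x F) ` R"
    using finite_subset_image[of "patterns F X" "\<lambda>x. restrict x F" X] unfolding patterns_def by blast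
  then show ?thesis using that[of R] by (simp add: patterns_def)
qed

text \<open>The configurations that must show the patterns and the patterns to be shown come from
  the same set, so shrinking it only weakens the condition. This lets recurrence survive the
  intersection of a chain.\<close>

lemma recurrent_subset:
  assumes "recurrent G D F X" "Y \<subseteq> X" "F' \<subseteq> F"
  shows "recurrent G D F' Y"
  unfolding recurrent_def
proof (intro ballI)
  fix x y assume "x \<in> Y" "y \<in> Y"
  then have "x \<in> X" "y \<in> X" using assms(2) by auto
  then obtain d where "d \<in> D" "\<forall>g\<in>F. x (g \<otimes>\<^bsub>G\<^esub> d) = y g"
    using assms(1) unfolding recurrent_def by blast
  then show "\<exists>d\<in>D. \<forall>g\<in>F'. x (g \<otimes>\<^bsub>G\<^esub> d) = y g" using assms(3) by (intro bexI[of _ d]) auto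
qed

lemma code_id_image:
  assumes "X \<subseteq> carrier G \<rightarrow>\<^sub>E A"
  shows "code G (\<lambda>a. a) ` X = X"
proof -
  have "code G (\<lambda>a. a) x = x" if "x \<in> X" for x
    using subsetD[OF assms that] by (auto simp: code_def PiE_iff extensional_restrict)
  then show ?thesis by simp
qed

lemma Sub_subset_PiE: "X \<in> Sub G A \<Longrightarrow> X \<subseteq> carrier G \<rightarrow>\<^sub>E topspace A"
  using closedin_subset[of "config_top G A" X] by (simp add: Sub_def)

section \<open>Vietoris neighbourhoods and openness of recurrence\<close>

lemma topspace_vietoris_fin: "topspace (vietoris_fin G A) = Sub_fin G A"
  by (auto simp: vietoris_fin_def)

lemma openin_vietoris_fin_patterns:
  assumes "X \<in> Sub_fin G A" "finite U" "U \<subseteq> carrier G"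
  shows "openin (vietoris_fin G A) {Y \<in> Sub_fin G A. patterns U Y = patterns U X}"
  unfolding vietoris_fin_def using assms by (intro topology_generated_by_Basis) blast

text \<open>A generator that contains \<open>X\<close> is the same set with \<open>X\<close> as its
  centre, and for an intersection the windows are united.\<close>

lemma vietoris_fin_nhd:
  assumes "openin (vietoris_fin G A) T" "X \<in> T"
  shows "\<exists>U. finite U \<and> U \<subseteq> carrier G \<and> (\<forall>Y\<in>Sub_fin G A. patterns U Y = patterns U X \<longrightarrow> Y \<in> T)"
proof -
  have "generate_topology_on {{Y \<in> Sub_fin G A. patterns U Y = patterns U X} | X U.
        X \<in> Sub_fin G A \<and> finite U \<and> U \<subseteq> carrier G} T"
    using assms(1) unfolding vietoris_fin_def openin_topology_generated_by_iff .
  then show ?thesis using assms(2)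
  proof induction
    case Empty
    then show ?case by simp
  next
    case (Int S T)
    then obtain U V where U: "finite U" "U \<subseteq> carrier G" and V: "finite V" "V \<subseteq> carrier G"
      and S: "\<forall>Y\<in>Sub_fin G A. patterns U Y = patterns U X \<longrightarrow> Y \<in> S"
      and T: "\<forall>Y\<in>Sub_fin G A. patterns V Y = patterns V X \<longrightarrow> Y \<in> T"
      by blast
    have "Y \<in> S \<inter> T" if "Y \<in> Sub_fin G A" "patterns (U \<union> V) Y = patterns (U \<union> V) X" for Y
      using that S T patterns_mono[OF that(2), of U] patterns_mono[OF that(2), of V] by simp
    then show ?case using U V by (intro exI[of _ "U \<union> V"]) simp
  next
    case (UN K)
    then obtain S where "S \<in> K" "X \<in> S" by blast
    then obtain U where "finite U" "U \<subseteq> carrier G"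
        "\<forall>Y\<in>Sub_fin G A. patterns U Y = patterns U X \<longrightarrow> Y \<in> S"
      using UN.IH[OF \<open>S \<in> K\<close> \<open>X \<in> S\<close>] by (elim exE conjE)
    then show ?case using \<open>S \<in> K\<close> by (intro exI[of _ U]) auto
  next
    case (Basis S)
    then show ?case by auto
  qed
qed

text \<open>If no initial segment of an enumeration of \<open>D\<close> sufficed for some
  \<open>y\<close>, the configurations missing the pattern of \<open>y\<close> along the first
  \<open>n\<close> translates would be nested nonempty closed sets, and a common element would
  contradict recurrence.\<close>

lemma recurrent_uniform:
  assumes X: "X \<in> Sub_fin G A" and A: "finite A" and F: "finite F" "F \<subseteq> carrier G"
    and D: "D \<subseteq> carrier G" "countable D" and "group G" and rec: "recurrent G D F X"
  shows "\<exists>E. finite E \<and> E \<subseteq> D \<and> recurrent G E F X"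
proof -
  interpret group G by fact
  have Xc: "closedin (config_top G (discrete_topology A)) X" and Xne: "X \<noteq> {}"
    using X by (auto simp: Sub_def)
  have "D \<noteq> {}" using Xne rec unfolding recurrent_def by blast
  then obtain e :: "nat \<Rightarrow> 'a" where e: "D = range e"
    using uncountable_def D(2) by metis
  have ed: "e k \<in> carrier G" for k using e D(1) by auto
  have "\<exists>n. \<forall>x\<in>X. \<exists>d\<in>e ` {..<n}. \<forall>g\<in>F. x (g \<otimes>\<^bsub>G\<^esub> d) = y g" if y: "y \<in> X" for y
  proof (rule ccontr)
    assume neg: "\<not> ?thesis"
    define C where "C n = {x \<in> X. \<forall>d\<in>e ` {..<n}. \<not> (\<forall>g\<in>F. x (g \<otimes>\<^bsub>G\<^esub> d) = y g)}" for n
    have "\<exists>x. \<forall>n. x \<in> C n"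
    proof (rule nested_configs_nonempty[OF A])
      show "C n \<noteq> {}" for n
      proof -
        have "\<not> (\<forall>x\<in>X. \<exists>d\<in>e ` {..<n}. \<forall>g\<in>F. x (g \<otimes>\<^bsub>G\<^esub> d) = y g)"
          using neg by (rule contrapos_nn) (rule exI)
        then obtain x where "x \<in> X" "\<not> (\<exists>d\<in>e ` {..<n}. \<forall>g\<in>F. x (g \<otimes>\<^bsub>G\<^esub> d) = y g)"
          unfolding ball_simps by (rule bexE)
        then have "x \<in> C n" unfolding C_def by simp
        then show ?thesis by blast
      qed
      show "decseq C" unfolding C_def decseq_def by auto
      show "closedin (config_top G (discrete_topology A)) (C n)" for n
      proof (rule closed_configsI)
        show "C n \<subseteq> carrier G \<rightarrow>\<^sub>E A"
          unfolding C_def by (rule subset_trans[OF Collect_subset closed_configs_subset[OF Xc]])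
        fix w assume w: "w \<in> carrier G \<rightarrow>\<^sub>E A"
          and lim: "\<And>F. finite F \<Longrightarrow> F \<subseteq> carrier G \<Longrightarrow> \<exists>x\<in>C n. \<forall>g\<in>F. x g = w g"
        have "w \<in> X"
        proof (rule closed_configs_limit[OF Xc w])
          fix F assume "finite F" "F \<subseteq> carrier G"
          from lim[OF this] show "\<exists>x\<in>X. \<forall>g\<in>F. x g = w g" by (auto simp: C_def)
        qed
        moreover have "\<not> (\<forall>g\<in>F. w (g \<otimes>\<^bsub>G\<^esub> d) = y g)" if d: "d \<in> e ` {..<n}" for d
        proof -
          have "finite ((\<lambda>g. g \<otimes>\<^bsub>G\<^esub> d) ` F)" "(\<lambda>g. g \<otimes>\<^bsub>G\<^esub> d) ` F \<subseteq> carrier G"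
            using F d ed by auto
          from lim[OF this] obtain x where "x \<in> C n" "\<forall>g\<in>F. x (g \<otimes>\<^bsub>G\<^esub> d) = w (g \<otimes>\<^bsub>G\<^esub> d)" by auto
          moreover from this(1) have "\<not> (\<forall>g\<in>F. x (g \<otimes>\<^bsub>G\<^esub> d) = y g)"
            using d unfolding C_def by fast
          ultimately show ?thesis by simp
        qed
        ultimately show "w \<in> C n" unfolding C_def by simp
      qed
    qed
    then obtain x where x: "\<And>n. x \<in> C n" by blast
    then have "x \<in> X" unfolding C_def by blast
    then have "\<exists>d\<in>D. \<forall>g\<in>F. x (g \<otimes>\<^bsub>G\<^esub> d) = y g"
      using rec y unfolding recurrent_def by simp
    then obtain k where "\<forall>g\<in>F. x (g \<otimes>\<^bsub>G\<^esub> e k) = y g" unfolding e by blast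
    moreover have "e k \<in> e ` {..<Suc k}" by simp
    ultimately show False using x[of "Suc k"] unfolding C_def by fast
  qed
  then obtain N where N: "\<And>y x. y \<in> X \<Longrightarrow> x \<in> X \<Longrightarrow> \<exists>d\<in>e ` {..<N y}. \<forall>g\<in>F. x (g \<otimes>\<^bsub>G\<^esub> d) = y g"
    by metis
  \<comment> \<open>The bound \<open>N y\<close> is not yet uniform, but only the
    \<open>F\<close>-pattern of \<open>y\<close> matters, and there are finitely many.\<close>
  have "X \<subseteq> carrier G \<rightarrow>\<^sub>E A" using closed_configs_subset[OF Xc] .
  then obtain R where R: "finite R" "R \<subseteq> X" "patterns F R = patterns F X"
    using finite_pattern_representatives[OF _ A F] by blast
  define E where "E = (\<Union>r\<in>R. e ` {..<N r})"
  have "\<exists>d\<in>E. \<forall>g\<in>F. x (g \<otimes>\<^bsub>G\<^esub> d) = y g" if xy: "x \<in> X" "y \<in> X" for x y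
  proof -
    obtain r where r: "r \<in> R" "\<And>g. g \<in> F \<Longrightarrow> r g = y g"
      using patterns_eqD[OF R(3)[symmetric] xy(2)] by blast
    then obtain d where "d \<in> e ` {..<N r}" "\<forall>g\<in>F. x (g \<otimes>\<^bsub>G\<^esub> d) = r g" using N R(2) xy(1) by blast
    then show ?thesis using r unfolding E_def by auto
  qed
  then have "recurrent G E F X" unfolding recurrent_def by blast
  moreover have "finite E" "E \<subseteq> D" using R(1) e unfolding E_def by auto
  ultimately show ?thesis by blast
qed

text \<open>With a finite set \<open>E\<close> of translates, recurrence can be read off the
  patterns on \<open>K\<close>, so it holds on a whole basic neighbourhood of
  \<open>X\<close>.\<close>

lemma openin_recurrent:
  assumes A: "finite A" and F: "finite F" "F \<subseteq> carrier G"
    and D: "D \<subseteq> carrier G" "countable D" and G: "group G"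
  shows "openin (vietoris_fin G A) {X \<in> Sub_fin G A. recurrent G D F X}"
proof (subst openin_subopen, intro ballI)
  interpret group G by fact
  fix X assume "X \<in> {X \<in> Sub_fin G A. recurrent G D F X}"
  then have X: "X \<in> Sub_fin G A" "recurrent G D F X" by auto
  obtain E where E: "finite E" "E \<subseteq> D" "recurrent G E F X"
    using recurrent_uniform[OF X(1) A F D G X(2)] by blast
  define K where "K = F \<union> (\<lambda>(g, d). g \<otimes>\<^bsub>G\<^esub> d) ` (F \<times> E)"
  have K: "finite K" "K \<subseteq> carrier G"
    using F E(1,2) D(1) by (auto simp: K_def)
  have KI: "g \<in> K" "d \<in> E \<Longrightarrow> g \<otimes>\<^bsub>G\<^esub> d \<in> K" if "g \<in> F" for g d
    using that by (auto simp: K_def)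
  have "recurrent G D F Y" if Y: "patterns K Y = patterns K X" for Y
    unfolding recurrent_def
  proof (intro ballI)
    fix x y assume "x \<in> Y" "y \<in> Y"
    then obtain x' y' where x': "x' \<in> X" "\<And>g. g \<in> K \<Longrightarrow> x' g = x g" and y': "y' \<in> X" "\<And>g. g \<in> K \<Longrightarrow> y' g = y g"
      using patterns_eqD[OF Y] by metis
    then obtain d where d: "d \<in> E" "\<forall>g\<in>F. x' (g \<otimes>\<^bsub>G\<^esub> d) = y' g"
      using E(3) unfolding recurrent_def by blast
    then have "\<forall>g\<in>F. x (g \<otimes>\<^bsub>G\<^esub> d) = y g" using x'(2) y'(2) KI by metis
    then show "\<exists>d\<in>D. \<forall>g\<in>F. x (g \<otimes>\<^bsub>G\<^esub> d) = y g" using d(1) E(2) by blast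
  qed
  then show "\<exists>T. openin (vietoris_fin G A) T \<and> X \<in> T \<and> T \<subseteq> {X \<in> Sub_fin G A. recurrent G D F X}"
    using openin_vietoris_fin_patterns[OF X(1) K] X(1) by blast
qed

section \<open>Recurrent refinements and their intersection\<close>

context group
begin

text \<open>Each conflict with a window already placed determines the new position \<open>d\<close>
  through an equation in the group; this excludes finitely many positions, and \<open>D\<close> is
  infinite.\<close>

lemma far_translates:
  assumes "finite R" "infinite D" "D \<subseteq> carrier G" and U: "finite U" "U \<subseteq> carrier G"
    and F: "finite F" "F \<subseteq> carrier G"
  shows "\<exists>\<gamma>. (\<forall>r\<in>R. \<gamma> r \<in> D) \<and>
    pairwise (\<lambda>r r'. apart G U ((\<lambda>f. f \<otimes> \<gamma> r) ` F) ((\<lambda>f. f \<otimes> \<gamma> r') ` F)) R"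
  using assms(1)
proof induction
  case empty
  then show ?case by simp
next
  case (insert r R)
  then obtain \<gamma> where \<gamma>: "\<forall>r\<in>R. \<gamma> r \<in> D"
      "pairwise (\<lambda>r r'. apart G U ((\<lambda>f. f \<otimes> \<gamma> r) ` F) ((\<lambda>f. f \<otimes> \<gamma> r') ` F)) R"
    by blast
  define S where "S = (\<Union>r\<in>R. (\<lambda>f. f \<otimes> \<gamma> r) ` F)"
  have S: "finite S" "S \<subseteq> carrier G"
    using insert.hyps(1) F \<gamma>(1) assms(3) by (auto simp: S_def)
  define N where "N = (\<lambda>(f, u, s). inv f \<otimes> (inv u \<otimes> s)) ` (F \<times> U \<times> S)
    \<union> (\<lambda>(f, u, s). inv f \<otimes> (u \<otimes> s)) ` (F \<times> U \<times> S)"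
  have NI: "inv f \<otimes> (inv u \<otimes> s) \<in> N" "inv f \<otimes> (u \<otimes> s) \<in> N" if "f \<in> F" "u \<in> U" "s \<in> S" for f u s
    using that by (force simp: N_def)+
  have "finite N" using F(1) U(1) S(1) by (simp add: N_def)
  then obtain d where d: "d \<in> D" "d \<notin> N" using assms(2) by (metis finite_subset subsetI)
  have dc: "d \<in> carrier G" using d(1) assms(3) by blast
  have ne: "u \<otimes> (f \<otimes> d) \<noteq> s" "u \<otimes> s \<noteq> f \<otimes> d" if h: "f \<in> F" "u \<in> U" "s \<in> S" for f u s
  proof -
    have c: "f \<in> carrier G" "u \<in> carrier G" "s \<in> carrier G" using h F(2) U(2) S(2) by auto
    show "u \<otimes> (f \<otimes> d) \<noteq> s"
    proof
      assume "u \<otimes> (f \<otimes> d) = s"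
      then have "f \<otimes> d = inv u \<otimes> s" using c dc by (metis inv_solve_left m_closed)
      then have "d = inv f \<otimes> (inv u \<otimes> s)" using c dc by (metis inv_solve_left inv_closed m_closed)
      then show False using NI(1)[OF h] d(2) by simp
    qed
    show "u \<otimes> s \<noteq> f \<otimes> d"
    proof
      assume "u \<otimes> s = f \<otimes> d"
      then have "d = inv f \<otimes> (u \<otimes> s)" using c dc by (metis inv_solve_left m_closed)
      then show False using NI(2)[OF h] d(2) by simp
    qed
  qed
  have ap: "apart G U ((\<lambda>f. f \<otimes> d) ` F) ((\<lambda>f. f \<otimes> \<gamma> r') ` F)"
    "apart G U ((\<lambda>f. f \<otimes> \<gamma> r') ` F) ((\<lambda>f. f \<otimes> d) ` F)" if "r' \<in> R" for r'
  proof -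
    have "f \<otimes> \<gamma> r' \<in> S" if "f \<in> F" for f
      using \<open>r' \<in> R\<close> that by (auto simp: S_def)
    then show "apart G U ((\<lambda>f. f \<otimes> d) ` F) ((\<lambda>f. f \<otimes> \<gamma> r') ` F)"
      "apart G U ((\<lambda>f. f \<otimes> \<gamma> r') ` F) ((\<lambda>f. f \<otimes> d) ` F)"
      using ne unfolding apart_iff by blast+
  qed
  define \<delta> where "\<delta> = \<gamma>(r := d)"
  have \<delta>: "\<delta> r = d" "\<And>r'. r' \<in> R \<Longrightarrow> \<delta> r' = \<gamma> r'" using insert.hyps(2) by (auto simp: \<delta>_def)
  have "pairwise (\<lambda>r r'. apart G U ((\<lambda>f. f \<otimes> \<delta> r) ` F) ((\<lambda>f. f \<otimes> \<delta> r') ` F)) (insert r R)"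
    using \<gamma>(2) ap \<delta> unfolding pairwise_def by simp
  moreover have "\<forall>r'\<in>insert r R. \<delta> r' \<in> D" using \<gamma>(1) d(1) \<delta> by simp
  ultimately show ?case by blast
qed

text \<open>The patterns are placed along \<open>D\<close> because their positions
  \<open>\<gamma> r\<close> get multiplied by a marker \<open>m\<close> in \<open>D\<close>: the
  pattern of \<open>r\<close> then occurs in \<open>y\<close> at
  \<open>\<gamma> r \<otimes> m\<close>, which again lies in \<open>D\<close>.\<close>

lemma recurrent_refinement:
  assumes cnt: "countable (carrier G)" and A: "finite A" and SI: "strongly_irreducible_fin G A X"
    and D: "subgroup D G" "infinite D" "admits_UFOs G D" and F: "finite F" "F \<subseteq> carrier G"
  shows "\<exists>Y\<subseteq>X. strongly_irreducible_fin G A Y \<and> patterns F Y = patterns F X \<and> recurrent G D F Y"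
proof -
  obtain U where X: "X \<in> Sub_fin G A" and U: "finite U" "U \<subseteq> carrier G" and gl: "gluing G U X"
    using SI unfolding strongly_irreducible_fin_iff by blast
  have Dc: "D \<subseteq> carrier G" using D(1) by (rule subgroup.subset)
  have Xne: "X \<noteq> {}" and Xc: "closedin (config_top G (discrete_topology A)) X"
    and Xinv: "\<And>g x. g \<in> carrier G \<Longrightarrow> x \<in> X \<Longrightarrow> shift G g x \<in> X"
    using X by (auto simp: Sub_def)
  obtain R where R: "finite R" "R \<subseteq> X" "patterns F R = patterns F X"
    using finite_pattern_representatives[OF closed_configs_subset[OF Xc] A F] by blast
  obtain \<gamma> where \<gamma>: "\<forall>r\<in>R. \<gamma> r \<in> D"
      "pairwise (\<lambda>r r'. apart G U ((\<lambda>f. f \<otimes> \<gamma> r) ` F) ((\<lambda>f. f \<otimes> \<gamma> r') ` F)) R"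
    using far_translates[OF R(1) D(2) Dc U F] by blast
  have \<gamma>c: "\<gamma> r \<in> carrier G" if "r \<in> R" for r using \<gamma>(1) that Dc by blast
  have "\<exists>z\<in>X. \<forall>r\<in>R. \<forall>g\<in>(\<lambda>f. f \<otimes> \<gamma> r) ` F. z g = shift G (inv \<gamma> r) r g"
  proof (rule glue_finite[OF gl Xne R(1) _ _ \<gamma>(2)])
    show "(\<lambda>f. f \<otimes> \<gamma> r) ` F \<subseteq> carrier G" if "r \<in> R" for r using \<gamma>c[OF that] F(2) by auto
    show "shift G (inv \<gamma> r) r \<in> X" if "r \<in> R" for r using \<gamma>c[OF that] R(2) that Xinv by auto
  qed
  then obtain z where z: "z \<in> X" "\<forall>r\<in>R. \<forall>g\<in>(\<lambda>f. f \<otimes> \<gamma> r) ` F. z g = shift G (inv \<gamma> r) r g" by blast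
  have zr: "z (f \<otimes> \<gamma> r) = r f" if "r \<in> R" "f \<in> F" for r f
  proof -
    have "f \<in> carrier G" "\<gamma> r \<in> carrier G" using that \<gamma>c F(2) by auto
    then show ?thesis using z(2) that by (simp add: shift_def m_assoc)
  qed
  define B where "B = (\<Union>r\<in>R. (\<lambda>f. f \<otimes> \<gamma> r) ` F)"
  have B: "finite B" "B \<subseteq> carrier G" using R(1) F \<gamma>c by (auto simp: B_def)
  \<comment> \<open>By \<open>windows_apart\<close>, copies of the window \<open>B\<close> at the
    points of a \<open>V\<^sub>0\<close>-spaced set are \<open>U\<close>-apart.\<close>
  define V\<^sub>0 where "V\<^sub>0 = (\<lambda>(b', u, b). inv b' \<otimes> (u \<otimes> b)) ` (B \<times> U \<times> B)"
  have "finite V\<^sub>0" "V\<^sub>0 \<subseteq> carrier G" using B U by (auto simp: V\<^sub>0_def intro!: m_closed inv_closed)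
  then obtain V where V: "V\<^sub>0 \<subseteq> V" "UFO G D V" using D(3) unfolding admits_UFOs_def by blast
  have Vf: "finite V" "V \<subseteq> carrier G" using V(2) by (auto simp: UFO_def)
  have UV: "inv b' \<otimes> (u \<otimes> b) \<in> V" if "u \<in> U" "b \<in> B" "b' \<in> B" for u b b'
    using that V(1) by (force simp: V\<^sub>0_def)
  let ?Y = "marked X V B z"
  have sub: "?Y \<subseteq> X" by (rule marked_subset)
  have inv: "shift G g y \<in> ?Y" if "y \<in> ?Y" "g \<in> carrier G" for g y
    using marked_invariant[OF X Vf(2) B(2) that] .
  \<comment> \<open>Stated for all \<open>w\<close> in \<open>X\<close>, not just marked ones:
    besides recurrence, this recovers every \<open>F\<close>-pattern of \<open>X\<close> from shifts
    of a single marked \<open>y\<close>.\<close>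
  have key: "\<exists>d\<in>D. \<forall>f\<in>F. y (f \<otimes> d) = w f" if y: "y \<in> ?Y" and w: "w \<in> X" for y w
  proof -
    obtain M where M: "maximal_spaced G V M" "\<forall>m\<in>M. \<forall>b\<in>B. y (b \<otimes> m) = z b"
      using y unfolding marked_def by blast
    obtain m where m: "m \<in> M" "m \<in> D" using UFO_meets_subgroup[OF V(2) D(1) M(1)] by blast
    obtain r where r: "r \<in> R" "\<And>g. g \<in> F \<Longrightarrow> r g = w g"
      using patterns_eqD[OF R(3)[symmetric] w] by blast
    have "y (f \<otimes> (\<gamma> r \<otimes> m)) = w f" if f: "f \<in> F" for f
    proof -
      have "f \<otimes> \<gamma> r \<in> B" using f r(1) by (auto simp: B_def)
      then have "y (f \<otimes> \<gamma> r \<otimes> m) = z (f \<otimes> \<gamma> r)" using M(2) m(1) by blast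
      moreover have "f \<otimes> \<gamma> r \<otimes> m = f \<otimes> (\<gamma> r \<otimes> m)"
        using f F(2) \<gamma>c[OF r(1)] m(2) Dc by (intro m_assoc) auto
      ultimately show ?thesis using zr[OF r(1) f] r(2)[OF f] by simp
    qed
    moreover have "\<gamma> r \<otimes> m \<in> D" using \<gamma>(1) r(1) m(2) D(1) by (simp add: subgroup.m_closed)
    ultimately show ?thesis by blast
  qed
  have "spaced G V {}" by (simp add: spaced_def)
  then obtain M where M: "maximal_spaced G V M" using spaced_extends_to_maximal by blast
  then have "spaced G V M" by (simp add: maximal_spaced_iff)
  then have "\<exists>x\<in>X. \<forall>m\<in>M. \<forall>b\<in>B. x (b \<otimes> m) = z b"
    using place_windows[OF cnt A X gl z(1) _ U(2) B(2) UV] by blast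
  then obtain y where y: "y \<in> ?Y" using M unfolding marked_def by blast
  have "?Y \<in> Sub_fin G A"
    using y inv closedin_marked[OF cnt Xc Vf B] unfolding Sub_def by blast
  then have "strongly_irreducible_fin G A ?Y"
    using marked_gluing[OF cnt A X gl z(1) U Vf B UV] unfolding strongly_irreducible_fin_iff by blast
  moreover have "patterns F ?Y = patterns F X"
  proof
    show "patterns F ?Y \<subseteq> patterns F X" using sub unfolding patterns_def by (rule image_mono)
    show "patterns F X \<subseteq> patterns F ?Y"
      unfolding patterns_subset_iff
    proof
      fix w assume "w \<in> X"
      then obtain d where d: "d \<in> D" "\<forall>f\<in>F. y (f \<otimes> d) = w f" using key[OF y] by blast
      then have "shift G d y \<in> ?Y" using inv[OF y] Dc by blast
      moreover have "\<forall>f\<in>F. shift G d y f = w f" using d(2) F(2) by (auto simp: shift_def)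
      ultimately show "\<exists>y\<in>?Y. \<forall>g\<in>F. y g = w g" by blast
    qed
  qed
  moreover have "recurrent G D F ?Y" using key sub unfolding recurrent_def by blast
  ultimately show ?thesis using sub by blast
qed

text \<open>From stage \<open>n\<close> on, the patterns on \<open>E n\<close> stay fixed, so the
  limit \<open>Y\<close> has the \<open>E n\<close>-patterns of \<open>C n\<close>; this makes
  \<open>Y\<close> nonempty and a limit of the \<open>C n\<close>. Its recurrence on
  \<open>E n\<close> is inherited from \<open>C (Suc n)\<close>.\<close>

lemma minimal_approximation:
  assumes cnt: "countable (carrier G)" and A: "finite A" and SI: "strongly_irreducible_fin G A X"
    and D: "subgroup D G" "infinite D" "admits_UFOs G D" and F: "finite F" "F \<subseteq> carrier G"
  shows "\<exists>Y\<in>SI_closure_fin G A. minimal_flow G (discrete_topology A) D Y \<and> patterns F Y = patterns F X"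
proof -
  obtain e :: "nat \<Rightarrow> 'a" where e: "carrier G = range e"
    using uncountable_def cnt by (metis carrier_not_empty)
  \<comment> \<open>\<open>E 0\<close> is \<open>F\<close> and every \<open>E n\<close> contains it,
    so no step changes the \<open>F\<close>-patterns of \<open>X\<close>.\<close>
  define E where "E n = F \<union> e ` {..<n}" for n
  have E: "finite (E n)" "E n \<subseteq> carrier G" for n using F e by (auto simp: E_def)
  have Emono: "E m \<subseteq> E n" if "m \<le> n" for m n using that by (auto simp: E_def)
  have Eex: "\<exists>n. H \<subseteq> E n" if H: "finite H" "H \<subseteq> carrier G" for H
  proof -
    obtain N where N: "finite N" "H = e ` N" using H e by (metis finite_subset_image)
    then obtain n where "N \<subseteq> {..<n}" using finite_nat_iff_bounded by blast
    then show ?thesis using N(2) unfolding E_def by blast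
  qed
  have Dc: "D \<subseteq> carrier G" using D(1) by (rule subgroup.subset)
  \<comment> \<open>The clause for \<open>n = 0\<close> makes the choice principle start at
    \<open>X\<close>.\<close>
  have "\<exists>C. \<forall>n. (strongly_irreducible_fin G A (C n) \<and> (n = 0 \<longrightarrow> C n = X)) \<and>
    (C (Suc n) \<subseteq> C n \<and> patterns (E n) (C (Suc n)) = patterns (E n) (C n) \<and> recurrent G D (E n) (C (Suc n)))"
  proof (rule dependent_nat_choice)
    show "\<exists>Z. strongly_irreducible_fin G A Z \<and> (0 = (0::nat) \<longrightarrow> Z = X)" using SI by blast
    fix Z and n :: nat assume "strongly_irreducible_fin G A Z \<and> (n = 0 \<longrightarrow> Z = X)"
    then have "strongly_irreducible_fin G A Z" by blast
    from recurrent_refinement[OF cnt A this D E[of n]]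
    show "\<exists>Y. (strongly_irreducible_fin G A Y \<and> (Suc n = 0 \<longrightarrow> Y = X)) \<and>
      (Y \<subseteq> Z \<and> patterns (E n) Y = patterns (E n) Z \<and> recurrent G D (E n) Y)"
      by auto
  qed
  then obtain C where C: "\<And>n. strongly_irreducible_fin G A (C n)" "C 0 = X" "\<And>n. C (Suc n) \<subseteq> C n"
      "\<And>n. patterns (E n) (C (Suc n)) = patterns (E n) (C n)" "\<And>n. recurrent G D (E n) (C (Suc n))"
    by metis
  have Cc: "C n \<in> Sub_fin G A" for n using C(1)[of n] by (simp add: strongly_irreducible_fin_iff)
  then have Ccl: "closedin (config_top G (discrete_topology A)) (C n)" for n by (simp add: Sub_def)
  have dec: "C n \<subseteq> C m" if "m \<le> n" for m n
    using decseq_SucI[of C] C(3) that by (simp add: decseq_def)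
  have pat: "patterns (E n) (C m) = patterns (E n) (C n)" if "n \<le> m" for n m
    using that
  proof (induction m rule: dec_induct)
    case (step m)
    then show ?case using patterns_mono[OF C(4)[of m] Emono[of n m]] by simp
  qed simp
  define Y where "Y = (\<Inter>n. C n)"
  have patY: "patterns (E n) Y = patterns (E n) (C n)" for n
  proof
    show "patterns (E n) Y \<subseteq> patterns (E n) (C n)" unfolding patterns_def Y_def by (intro image_mono) blast
    show "patterns (E n) (C n) \<subseteq> patterns (E n) Y"
      unfolding patterns_subset_iff
    proof
      fix x assume x: "x \<in> C n"
      \<comment> \<open>Equal patterns give a suitable configuration in each
        \<open>C (n + k)\<close> separately; compactness supplies one that lies in all of
        them.\<close>
      have "\<exists>y. \<forall>k. y \<in> {y \<in> C (n + k). \<forall>g\<in>E n. y g = x g}"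
      proof (rule nested_configs_nonempty[OF A])
        show "closedin (config_top G (discrete_topology A)) {y \<in> C (n + k). \<forall>g\<in>E n. y g = x g}" for k
          by (rule closedin_pointwise_condition[OF Ccl E(2)])
        show "{y \<in> C (n + k). \<forall>g\<in>E n. y g = x g} \<noteq> {}" for k
          by (rule patterns_eqD[OF pat[of n "n + k", symmetric] x]) auto
        show "decseq (\<lambda>k. {y \<in> C (n + k). \<forall>g\<in>E n. y g = x g})"
          unfolding decseq_def
        proof (intro allI impI)
          fix i j :: nat assume "i \<le> j"
          then have "C (n + j) \<subseteq> C (n + i)" by (intro dec) simp
          then show "{y \<in> C (n + j). \<forall>g\<in>E n. y g = x g} \<subseteq> {y \<in> C (n + i). \<forall>g\<in>E n. y g = x g}"
            by blast
        qed
      qed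
      then obtain y where y: "\<And>k. y \<in> C (n + k)" "\<And>g. g \<in> E n \<Longrightarrow> y g = x g" by blast
      have "y \<in> C m" for m using y(1)[of m] dec[of m "n + m"] by auto
      then show "\<exists>y\<in>Y. \<forall>g\<in>E n. y g = x g" using y(2) unfolding Y_def by blast
    qed
  qed
  have "Y \<in> Sub_fin G A"
    unfolding Sub_def
  proof (intro CollectI conjI ballI)
    have "C 0 \<noteq> {}" using Cc[of 0] by (simp add: Sub_def)
    then show "Y \<noteq> {}" using patY[of 0] unfolding patterns_def by blast
    show "closedin (config_top G (discrete_topology A)) Y"
      unfolding Y_def using Ccl by (intro closedin_INT) auto
    show "shift G g x \<in> Y" if "g \<in> carrier G" "x \<in> Y" for g x
      using Cc that unfolding Y_def Sub_def by blast
  qed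
  moreover have "Y \<in> SI_closure_fin G A"
    unfolding SI_closure_fin_def in_closure_of topspace_vietoris_fin
  proof (intro conjI allI impI)
    show "Y \<in> Sub_fin G A" by fact
    fix T assume "Y \<in> T \<and> openin (vietoris_fin G A) T"
    then obtain H where H: "finite H" "H \<subseteq> carrier G"
        "\<forall>Z\<in>Sub_fin G A. patterns H Z = patterns H Y \<longrightarrow> Z \<in> T"
      using vietoris_fin_nhd[of G A T Y] by blast
    obtain n where "H \<subseteq> E n" using Eex H by blast
    then have "C n \<in> T" using H(3) Cc patterns_mono[OF patY[symmetric]] by blast
    then show "\<exists>Z. Z \<in> {X. strongly_irreducible_fin G A X} \<and> Z \<in> T" using C(1) by blast
  qed
  moreover have "recurrent G D H Y" if H: "finite H" "H \<subseteq> carrier G" for H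
  proof -
    obtain n where n: "H \<subseteq> E n" using Eex[OF H] by (elim exE)
    have "Y \<subseteq> C (Suc n)" unfolding Y_def by blast
    then show ?thesis using recurrent_subset[OF C(5) _ n] by simp
  qed
  then have "minimal_flow G (discrete_topology A) D Y"
    using minimal_flow_iff_recurrent[OF \<open>Y \<in> Sub_fin G A\<close> level_base_discrete Dc is_group]
      code_id_image[of Y G A] Sub_subset_PiE[OF \<open>Y \<in> Sub_fin G A\<close>] by simp
  moreover have "patterns F Y = patterns F X"
    using patY[of 0] C(2) by (simp add: E_def)
  ultimately show ?thesis by blast
qed

end

subsection \<open>The Cantor alphabet\<close>

lemma trunc_eq_code: "trunc G n = code G (\<lambda>a. restrict a {..<n})"
  by (simp add: fun_eq_iff trunc_def code_def)

lemma code_code: "code G f (code G h x) = code G (\<lambda>a. f (h a)) x"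
  by (simp add: code_def restrict_def fun_eq_iff)

lemma patterns_code:
  assumes "patterns U X = patterns U Y" "U \<subseteq> carrier G"
  shows "patterns U (code G f ` X) = patterns U (code G f ` Y)"
proof -
  have "patterns U (code G f ` Z) = (\<lambda>p. \<lambda>g\<in>U. f (p g)) ` patterns U Z" for Z
    using assms(2) by (auto simp: patterns_def image_image code_def restrict_def subset_iff fun_eq_iff intro!: image_cong)
  then show ?thesis using assms(1) by metis
qed

lemma gluing_code:
  assumes "gluing G U X"
  shows "gluing G U (code G f ` X)"
  unfolding gluing_def
proof (intro ballI allI impI, elim conjE imageE)
  fix y\<^sub>0 y\<^sub>1 S\<^sub>0 S\<^sub>1 x\<^sub>0 x\<^sub>1
  assume S: "S\<^sub>0 \<subseteq> carrier G" "S\<^sub>1 \<subseteq> carrier G" "apart G U S\<^sub>0 S\<^sub>1"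
    and x: "y\<^sub>0 = code G f x\<^sub>0" "x\<^sub>0 \<in> X" "y\<^sub>1 = code G f x\<^sub>1" "x\<^sub>1 \<in> X"
  obtain w where "w \<in> X" "\<And>g. g \<in> S\<^sub>0 \<Longrightarrow> w g = x\<^sub>0 g" "\<And>g. g \<in> S\<^sub>1 \<Longrightarrow> w g = x\<^sub>1 g"
    using gluingD[OF assms x(2,4) S] by blast
  then show "\<exists>y\<in>code G f ` X. (\<forall>g\<in>S\<^sub>0. y g = y\<^sub>0 g) \<and> (\<forall>g\<in>S\<^sub>1. y g = y\<^sub>1 g)"
    using S(1,2) unfolding x(1,3) by (intro bexI[of _ "code G f w"]) (auto simp: code_def)
qed

lemma recurrent_code:
  assumes "recurrent G D F X" "F \<subseteq> carrier G" "D \<subseteq> carrier G" "group G"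
  shows "recurrent G D F (code G f ` X)"
proof -
  interpret group G by fact
  have "\<exists>d\<in>D. \<forall>g\<in>F. code G f x (g \<otimes>\<^bsub>G\<^esub> d) = code G f y g" if xy: "x \<in> X" "y \<in> X" for x y
  proof -
    obtain d where d: "d \<in> D" "\<forall>g\<in>F. x (g \<otimes>\<^bsub>G\<^esub> d) = y g"
      using assms(1) xy unfolding recurrent_def by blast
    then have "\<forall>g\<in>F. code G f x (g \<otimes>\<^bsub>G\<^esub> d) = code G f y g"
      using assms(2,3) by (auto simp: code_def subset_iff)
    then show ?thesis using d(1) by blast
  qed
  then show ?thesis unfolding recurrent_def by blast
qed

lemma strongly_irreducible_code:
  assumes "group G" "finite A" "f \<in> A \<rightarrow> A'" "strongly_irreducible_fin G A X"
  shows "strongly_irreducible_fin G A' (code G f ` X)"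
proof -
  have "code G f ` X \<in> Sub_fin G A'"
    by (rule Sub_code[OF _ assms(1)])
      (use assms in \<open>auto simp: strongly_irreducible_fin_iff compact_space_discrete_topology\<close>)
  then show ?thesis using assms(4) gluing_code unfolding strongly_irreducible_fin_iff by blast
qed

lemma finite_words: "finite (words n)"
  by (simp add: words_def finite_PiE)

lemma topspace_cantor: "topspace cantor = UNIV \<rightarrow>\<^sub>E {..<2}"
  by (simp add: cantor_def)

lemma continuous_map_cantor_restrict:
  "continuous_map cantor (discrete_topology (words n)) (\<lambda>a. restrict a {..<n})"
  unfolding continuous_map_def
proof (intro conjI allI impI)
  show "(\<lambda>a. restrict a {..<n}) \<in> topspace cantor \<rightarrow> topspace (discrete_topology (words n))"
    by (simp add: topspace_cantor words_def PiE_iff)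
  fix U
  show "openin cantor {x \<in> topspace cantor. restrict x {..<n} \<in> U}"
  proof (subst openin_subopen, intro ballI)
    fix a assume a: "a \<in> {x \<in> topspace cantor. restrict x {..<n} \<in> U}"
    let ?T = "{b \<in> topspace cantor. restrict b {..<n} = restrict a {..<n}}"
    have "openin cantor ?T" using level_base_cantor a unfolding level_base_def by simp
    moreover have "a \<in> ?T" "?T \<subseteq> {x \<in> topspace cantor. restrict x {..<n} \<in> U}" using a by auto
    ultimately show "\<exists>T. openin cantor T \<and> a \<in> T \<and> T \<subseteq> {x \<in> topspace cantor. restrict x {..<n} \<in> U}"
      by blast
  qed
qed

lemma Sub_trunc:
  assumes "group G" "X \<in> Sub_cantor G"
  shows "trunc G n ` X \<in> Sub_fin G (words n)"
  unfolding trunc_eq_code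
  by (rule Sub_code[OF assms(2,1) continuous_map_cantor_restrict compact_cantor Hausdorff_space_discrete_topology])

text \<open>Truncation to \<open>m\<close> digits factors through truncation to \<open>n\<close>
  digits, and letterwise maps act on patterns.\<close>

lemma patterns_trunc_mono:
  assumes "patterns U' (trunc G n ` X) = patterns U' (trunc G n ` Y)" "m \<le> n" "U \<subseteq> U'" "U' \<subseteq> carrier G"
  shows "patterns U (trunc G m ` X) = patterns U (trunc G m ` Y)"
proof -
  have eq: "trunc G m ` Z = code G (\<lambda>a. restrict a {..<m}) ` (trunc G n ` Z)" for Z
    using assms(2) by (simp add: trunc_eq_code image_image code_code Int_absorb1)
  show ?thesis
    unfolding eq[of X] eq[of Y] using patterns_mono[OF patterns_code[OF assms(1,4)] assms(3)] .
qed

lemma openin_vietoris_cantor_vimage: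
  "openin (vietoris_fin G (words n)) W \<Longrightarrow>
    openin (vietoris_cantor G) {X \<in> Sub_cantor G. trunc G n ` X \<in> W}"
  unfolding vietoris_cantor_def
  by (intro topology_generated_by_Basis CollectI exI[of _ n] exI[of _ W] conjI refl)

lemma topspace_vietoris_cantor:
  assumes "group G"
  shows "topspace (vietoris_cantor G) = Sub_cantor G"
proof
  show "topspace (vietoris_cantor G) \<subseteq> Sub_cantor G"
    by (auto simp: vietoris_cantor_def)
  \<comment> \<open>Level 0 with the full space of subshifts gives a generator that contains
    everything.\<close>
  have "openin (vietoris_cantor G) {X \<in> Sub_cantor G. trunc G 0 ` X \<in> topspace (vietoris_fin G (words 0))}"
    by (intro openin_vietoris_cantor_vimage) simp
  moreover have "{X \<in> Sub_cantor G. trunc G 0 ` X \<in> topspace (vietoris_fin G (words 0))} = Sub_cantor G"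
    using Sub_trunc[OF assms] unfolding topspace_vietoris_fin by blast
  ultimately show "Sub_cantor G \<subseteq> topspace (vietoris_cantor G)"
    using openin_subset by metis
qed

text \<open>An intersection may combine different levels; the larger level together with the union
  of the windows controls both.\<close>

lemma vietoris_cantor_nhd:
  assumes "openin (vietoris_cantor G) T" "X \<in> T" "group G"
  shows "\<exists>n U. finite U \<and> U \<subseteq> carrier G \<and>
    (\<forall>Y\<in>Sub_cantor G. patterns U (trunc G n ` Y) = patterns U (trunc G n ` X) \<longrightarrow> Y \<in> T)"
proof -
  have "generate_topology_on
     {{X \<in> Sub_cantor G. trunc G n ` X \<in> W} | n W. openin (vietoris_fin G (words n)) W} T"
    using assms(1) unfolding vietoris_cantor_def openin_topology_generated_by_iff .
  then show ?thesis using assms(2)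
  proof induction
    case Empty
    then show ?case by simp
  next
    case (Int S T)
    then obtain m n U V where U: "finite U" "U \<subseteq> carrier G" and V: "finite V" "V \<subseteq> carrier G"
      and S: "\<forall>Y\<in>Sub_cantor G. patterns U (trunc G m ` Y) = patterns U (trunc G m ` X) \<longrightarrow> Y \<in> S"
      and T: "\<forall>Y\<in>Sub_cantor G. patterns V (trunc G n ` Y) = patterns V (trunc G n ` X) \<longrightarrow> Y \<in> T"
      by blast
    have "Y \<in> S \<inter> T" if Y: "Y \<in> Sub_cantor G"
        "patterns (U \<union> V) (trunc G (max m n) ` Y) = patterns (U \<union> V) (trunc G (max m n) ` X)" for Y
      using Y(1) S T U V patterns_trunc_mono[OF Y(2), of m U] patterns_trunc_mono[OF Y(2), of n V] by simp
    then show ?case using U V by (intro exI[of _ "max m n"] exI[of _ "U \<union> V"]) simp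
  next
    case (UN K)
    then obtain S where "S \<in> K" "X \<in> S" by blast
    then obtain n U where "finite U" "U \<subseteq> carrier G"
        "\<forall>Y\<in>Sub_cantor G. patterns U (trunc G n ` Y) = patterns U (trunc G n ` X) \<longrightarrow> Y \<in> S"
      using UN.IH[OF \<open>S \<in> K\<close> \<open>X \<in> S\<close>] by (elim exE conjE)
    then show ?case using \<open>S \<in> K\<close> by (intro exI[of _ n] exI[of _ U]) auto
  next
    case (Basis S)
    then obtain n W where S: "S = {X \<in> Sub_cantor G. trunc G n ` X \<in> W}" "openin (vietoris_fin G (words n)) W"
      by blast
    then obtain U where "finite U" "U \<subseteq> carrier G"
        "\<forall>Y\<in>Sub_fin G (words n). patterns U Y = patterns U (trunc G n ` X) \<longrightarrow> Y \<in> W"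
      using vietoris_fin_nhd[OF S(2), of "trunc G n ` X"] Basis.prems by blast
    then show ?case
      using Sub_trunc[OF assms(3)] unfolding S(1) by (intro exI[of _ n] exI[of _ U]) simp
  qed
qed

section \<open>Lifting subshifts from a finite level to the Cantor alphabet\<close>

definition zero_extend :: "('a, 'b) monoid_scheme \<Rightarrow> nat \<Rightarrow> ('a \<Rightarrow> nat \<Rightarrow> nat) \<Rightarrow> ('a \<Rightarrow> nat \<Rightarrow> nat)" where
  "zero_extend G n = code G (\<lambda>a i. if i < n then a i else 0)"

lemma Sub_zero_extend:
  assumes "group G" "X \<in> Sub_fin G (words n)"
  shows "zero_extend G n ` X \<in> Sub_cantor G"
  unfolding zero_extend_def
proof (rule Sub_code[OF assms(2,1)])
  show "continuous_map (discrete_topology (words n)) cantor (\<lambda>a i. if i < n then a i else 0)"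
    by (auto simp: topspace_cantor words_def)
  show "compact_space (discrete_topology (words n))"
    by (simp add: compact_space_discrete_topology finite_words)
qed (rule Hausdorff_cantor)

lemma trunc_zero_extend:
  assumes "X \<in> Sub_fin G (words n)"
  shows "trunc G n ` zero_extend G n ` X = X"
proof -
  have "trunc G n (zero_extend G n x) = x" if "x \<in> X" for x
  proof
    fix g
    have x: "x \<in> carrier G \<rightarrow>\<^sub>E words n"
      using subsetD[OF Sub_subset_PiE[OF assms] that] by simp
    show "trunc G n (zero_extend G n x) g = x g"
    proof (cases "g \<in> carrier G")
      case True
      then have "x g \<in> words n" using x by (auto simp: PiE_iff)
      then show ?thesis using True
        by (auto simp: trunc_def zero_extend_def code_def words_def PiE_iff extensional_def fun_eq_iff)
    next
      case False
      then show ?thesis using x by (simp add: trunc_def PiE_iff extensional_def)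
    qed
  qed
  then show ?thesis by (simp add: image_image)
qed

text \<open>Every truncation of the padded subshift, above or below level \<open>n\<close>, is a
  letterwise image of \<open>X\<close>. Strong irreducibility, equality of patterns and recurrence
  therefore pass from \<open>X\<close> to all levels at once.\<close>

lemma trunc_zero_extend_eq_code:
  "trunc G m ` zero_extend G n ` X = code G (\<lambda>a. restrict (\<lambda>i. if i < n then a i else 0) {..<m}) ` X"
  by (simp add: trunc_eq_code zero_extend_def image_image code_code)

lemma strongly_irreducible_zero_extend:
  assumes "group G" "strongly_irreducible_fin G (words n) X"
  shows "strongly_irreducible_cantor G (zero_extend G n ` X)"
  unfolding strongly_irreducible_cantor_def
proof (intro conjI allI)
  show "zero_extend G n ` X \<in> Sub_cantor G"
    using assms by (intro Sub_zero_extend) (simp_all add: strongly_irreducible_fin_iff)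
  show "strongly_irreducible_fin G (words m) (trunc G m ` zero_extend G n ` X)" for m
    unfolding trunc_zero_extend_eq_code
    by (rule strongly_irreducible_code[OF assms(1) finite_words _ assms(2)]) (simp add: words_def PiE_iff)
qed

text \<open>Subshifts with equal \<open>U\<close>-patterns over \<open>words n\<close> have paddings
  with equal \<open>U\<close>-patterns at every level \<open>m\<close>, so strongly irreducible
  approximants of \<open>X\<close> pad to approximants of the padding.\<close>

lemma SI_closure_zero_extend:
  assumes "group G" "X \<in> SI_closure_fin G (words n)"
  shows "zero_extend G n ` X \<in> SI_closure_cantor G"
  unfolding SI_closure_cantor_def in_closure_of topspace_vietoris_cantor[OF assms(1)]
proof (intro conjI allI impI)
  have X: "X \<in> Sub_fin G (words n)"
    using assms(2) unfolding SI_closure_fin_def in_closure_of topspace_vietoris_fin by (rule conjunct1)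
  show "zero_extend G n ` X \<in> Sub_cantor G" by (rule Sub_zero_extend[OF assms(1) X])
  fix T assume T: "zero_extend G n ` X \<in> T \<and> openin (vietoris_cantor G) T"
  obtain m U where U: "finite U" "U \<subseteq> carrier G" and
    nhd: "\<forall>Y\<in>Sub_cantor G. patterns U (trunc G m ` Y) = patterns U (trunc G m ` zero_extend G n ` X) \<longrightarrow> Y \<in> T"
    using vietoris_cantor_nhd[OF conjunct2[OF T] conjunct1[OF T] assms(1)] by (elim exE conjE)
  have "\<forall>N. X \<in> N \<and> openin (vietoris_fin G (words n)) N \<longrightarrow>
      (\<exists>Y. Y \<in> {X. strongly_irreducible_fin G (words n) X} \<and> Y \<in> N)"
    using assms(2) unfolding SI_closure_fin_def in_closure_of by (rule conjunct2)
  from spec[OF this, of "{Y \<in> Sub_fin G (words n). patterns U Y = patterns U X}"] obtain Y where Y: "strongly_irreducible_fin G (words n) Y" "patterns U Y = patterns U X"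
    using openin_vietoris_fin_patterns[OF X U] X by auto
  have SI: "strongly_irreducible_cantor G (zero_extend G n ` Y)"
    by (rule strongly_irreducible_zero_extend[OF assms(1) Y(1)])
  have "patterns U (trunc G m ` zero_extend G n ` Y) = patterns U (trunc G m ` zero_extend G n ` X)"
    unfolding trunc_zero_extend_eq_code by (rule patterns_code[OF Y(2) U(2)])
  moreover have "zero_extend G n ` Y \<in> Sub_cantor G" using SI by (simp add: strongly_irreducible_cantor_def)
  ultimately have "zero_extend G n ` Y \<in> T" using nhd by simp
  then show "\<exists>y. y \<in> {X. strongly_irreducible_cantor G X} \<and> y \<in> T" using SI by blast
qed

text \<open>Only points of \<open>S\<close> have to be approximated, because every nonempty open
  subset of the closure meets \<open>S\<close>.\<close>

lemma dense_gdelta_in_closureI: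
  assumes "countable I" "\<And>i. i \<in> I \<Longrightarrow> openin T (W i)"
    and M: "M = {X \<in> T closure_of S. \<forall>i\<in>I. X \<in> W i}"
    and dense: "\<And>X N. X \<in> S \<Longrightarrow> X \<in> N \<Longrightarrow> openin T N \<Longrightarrow> \<exists>Y\<in>M. Y \<in> N"
  shows "dense_gdelta_in (subtopology T (T closure_of S)) M"
proof -
  let ?C = "T closure_of S"
  have top: "topspace (subtopology T ?C) = ?C"
    using closure_of_subset_topspace[of T S] by auto
  \<comment> \<open>Inserting \<open>?C\<close> keeps the family nonempty and its intersection
    inside the closure, also for empty \<open>I\<close>.\<close>
  have "M = \<Inter>(insert ?C ((\<lambda>i. W i \<inter> ?C) ` I))" using M by auto
  moreover have "gdelta_in (subtopology T ?C) (\<Inter>(insert ?C ((\<lambda>i. W i \<inter> ?C) ` I)))"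
  proof (rule gdelta_in_Inter)
    show "countable (insert ?C ((\<lambda>i. W i \<inter> ?C) ` I))" using assms(1) by simp
    show "gdelta_in (subtopology T ?C) Z" if "Z \<in> insert ?C ((\<lambda>i. W i \<inter> ?C) ` I)" for Z
    proof (rule open_imp_gdelta_in)
      have "openin (subtopology T ?C) ?C" using openin_topspace[of "subtopology T ?C"] unfolding top .
      moreover have "openin (subtopology T ?C) (W i \<inter> ?C)" if "i \<in> I" for i
        using assms(2)[OF that] by (rule openin_subtopology_Int)
      ultimately show "openin (subtopology T ?C) Z" using that by blast
    qed
  qed simp
  moreover have "subtopology T ?C closure_of M = ?C"
  proof
    show "subtopology T ?C closure_of M \<subseteq> ?C"
      using closure_of_subset_topspace[of "subtopology T ?C" M] unfolding top .
    show "?C \<subseteq> subtopology T ?C closure_of M"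
    proof
      fix X assume X: "X \<in> ?C"
      have "\<exists>Y. Y \<in> M \<and> Y \<in> N" if N: "X \<in> N" "openin (subtopology T ?C) N" for N
      proof -
        obtain N' where N': "openin T N'" "N = N' \<inter> ?C" using N(2) unfolding openin_subtopology by blast
        then obtain Z where "Z \<in> S" "Z \<in> N'" using X N(1) unfolding in_closure_of by blast
        then obtain Y where "Y \<in> M" "Y \<in> N'" using dense N'(1) by blast
        then show ?thesis using N'(2) M by blast
      qed
      then show "X \<in> subtopology T ?C closure_of M" using X unfolding in_closure_of[of X "subtopology T ?C"] top by blast
    qed
  qed
  ultimately show ?thesis unfolding dense_gdelta_in_def top by metis
qed

theorem proposition8:
  fixes G :: "('a, 'b) monoid_scheme" and D :: "'a set" and k :: nat
  assumes "group G" and "countable (carrier G)" and "infinite (carrier G)"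
    and "subgroup D G" and "countable D" and "infinite D"
    and "admits_UFOs G D"
  shows "dense_gdelta_in (SI_closure_fin_top G {..<k})
           {X \<in> SI_closure_fin G {..<k}. minimal_flow G (discrete_topology {..<k}) D X}
       \<and> dense_gdelta_in (SI_closure_cantor_top G)
           {X \<in> SI_closure_cantor G. minimal_flow G cantor D X}"
proof
  interpret group G by fact
  have D: "D \<subseteq> carrier G" using \<open>subgroup D G\<close> by (rule subgroup.subset)
  \<comment> \<open>Finite windows index the open conditions; a countable group has only countably
    many.\<close>
  let ?\<F> = "{F. finite F \<and> F \<subseteq> carrier G}"
  have cnt: "countable ?\<F>"
    using countable_Collect_finite_subset[OF \<open>countable (carrier G)\<close>] by (simp add: conj_commute)
  let ?A = "{..<k}"
  have fin_sub: "X \<in> Sub_fin G A" if "X \<in> SI_closure_fin G A" for X and A :: "'c set"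
    using that unfolding SI_closure_fin_def in_closure_of topspace_vietoris_fin by (rule conjunct1)
  have fin_iff: "minimal_flow G (discrete_topology A) D X \<longleftrightarrow> (\<forall>F\<in>?\<F>. recurrent G D F X)"
    if "X \<in> Sub_fin G A" for X and A :: "'c set"
    using minimal_flow_iff_recurrent[OF that level_base_discrete D is_group]
      code_id_image[of X G A] Sub_subset_PiE[OF that] by simp
  show "dense_gdelta_in (SI_closure_fin_top G ?A)
      {X \<in> SI_closure_fin G ?A. minimal_flow G (discrete_topology ?A) D X}"
    unfolding SI_closure_fin_top_def SI_closure_fin_def
  proof (rule dense_gdelta_in_closureI[OF cnt], fold SI_closure_fin_def)
    show "openin (vietoris_fin G ?A) {X \<in> Sub_fin G ?A. recurrent G D F X}" if "F \<in> ?\<F>" for F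
      using that \<open>countable D\<close> D by (intro openin_recurrent) auto
    show "{X \<in> SI_closure_fin G ?A. minimal_flow G (discrete_topology ?A) D X} =
        {X \<in> SI_closure_fin G ?A. \<forall>F\<in>?\<F>. X \<in> {X \<in> Sub_fin G ?A. recurrent G D F X}}"
      using fin_sub fin_iff by blast
    fix X N assume X: "X \<in> {X. strongly_irreducible_fin G ?A X}" "X \<in> N" "openin (vietoris_fin G ?A) N"
    obtain U where U: "finite U" "U \<subseteq> carrier G" "\<forall>Y\<in>Sub_fin G ?A. patterns U Y = patterns U X \<longrightarrow> Y \<in> N"
      using vietoris_fin_nhd[OF X(3,2)] by blast
    obtain Y where "Y \<in> SI_closure_fin G ?A" "minimal_flow G (discrete_topology ?A) D Y"
        "patterns U Y = patterns U X"
      using minimal_approximation[OF assms(2) _ _ assms(4,6,7) U(1,2), of ?A X] X(1) by blast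
    then show "\<exists>Y\<in>{X \<in> SI_closure_fin G ?A. minimal_flow G (discrete_topology ?A) D X}. Y \<in> N"
      using U(3) fin_sub by blast
  qed
  have cantor_sub: "X \<in> Sub_cantor G" if "X \<in> SI_closure_cantor G" for X
    using that unfolding SI_closure_cantor_def in_closure_of topspace_vietoris_cantor[OF is_group]
    by (rule conjunct1)
  have cantor_iff: "minimal_flow G cantor D X \<longleftrightarrow> (\<forall>p\<in>UNIV \<times> ?\<F>. recurrent G D (snd p) (trunc G (fst p) ` X))"
    if "X \<in> Sub_cantor G" for X
    using minimal_flow_iff_recurrent[OF that level_base_cantor D is_group]
    unfolding trunc_eq_code by auto
  show "dense_gdelta_in (SI_closure_cantor_top G)
      {X \<in> SI_closure_cantor G. minimal_flow G cantor D X}"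
    unfolding SI_closure_cantor_top_def SI_closure_cantor_def
  proof (rule dense_gdelta_in_closureI, fold SI_closure_cantor_def)
    show "countable ((UNIV :: nat set) \<times> ?\<F>)" using cnt by simp
    \<comment> \<open>Recurrence at one level and on one window, written as a preimage under
      truncation so that openness comes from the finite alphabet.\<close>
    let ?W = "\<lambda>p. {X \<in> Sub_cantor G. trunc G (fst p) ` X \<in>
      {Z \<in> Sub_fin G (words (fst p)). recurrent G D (snd p) Z}}"
    show "openin (vietoris_cantor G) (?W p)" if "p \<in> UNIV \<times> ?\<F>" for p
      using that \<open>countable D\<close> D
      by (intro openin_vietoris_cantor_vimage openin_recurrent) (auto simp: finite_words)
    show "{X \<in> SI_closure_cantor G. minimal_flow G cantor D X} =
        {X \<in> SI_closure_cantor G. \<forall>p\<in>UNIV \<times> ?\<F>. X \<in> ?W p}"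
      using cantor_sub cantor_iff Sub_trunc[OF is_group] by blast
    fix X N assume X: "X \<in> {X. strongly_irreducible_cantor G X}" "X \<in> N" "openin (vietoris_cantor G) N"
    obtain n U where U: "finite U" "U \<subseteq> carrier G"
        "\<forall>Y\<in>Sub_cantor G. patterns U (trunc G n ` Y) = patterns U (trunc G n ` X) \<longrightarrow> Y \<in> N"
      using vietoris_cantor_nhd[OF X(3,2) is_group] by blast
    have "strongly_irreducible_fin G (words n) (trunc G n ` X)"
      using X(1) by (simp add: strongly_irreducible_cantor_def)
    then obtain Y where Y: "Y \<in> SI_closure_fin G (words n)" "minimal_flow G (discrete_topology (words n)) D Y"
        "patterns U Y = patterns U (trunc G n ` X)"
      using minimal_approximation[OF assms(2) finite_words _ assms(4,6,7) U(1,2)] by blast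
    have Ysub: "Y \<in> Sub_fin G (words n)" using Y(1) by (rule fin_sub)
    \<comment> \<open>The basic neighbourhood of \<open>X\<close> inside \<open>N\<close> sees only
      the first \<open>n\<close> digits, and there \<open>?Z\<close> truncates back to
      \<open>Y\<close>, which has the right \<open>U\<close>-patterns.\<close>
    let ?Z = "zero_extend G n ` Y"
    have Z: "?Z \<in> SI_closure_cantor G" by (rule SI_closure_zero_extend[OF is_group Y(1)])
    moreover have "minimal_flow G cantor D ?Z"
      unfolding cantor_iff[OF cantor_sub[OF Z]]
    proof
      fix p :: "nat \<times> 'a set" assume p: "p \<in> UNIV \<times> ?\<F>"
      then have "recurrent G D (snd p) Y" using Y(2) fin_iff[OF Ysub] by auto
      then show "recurrent G D (snd p) (trunc G (fst p) ` ?Z)"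
        unfolding trunc_zero_extend_eq_code using p D by (intro recurrent_code is_group) auto
    qed
    moreover have "?Z \<in> N"
      using U(3) cantor_sub[OF Z] trunc_zero_extend[OF Ysub] Y(3) by simp
    ultimately show "\<exists>Y\<in>{X \<in> SI_closure_cantor G. minimal_flow G cantor D X}. Y \<in> N" by blast
  qed
qed

end
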